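(* Let $s\ge1$ be an integer, let $(N^2,\langle\cdot,\cdot\rangle)$ be a two-dimensional Riemannian manifold with constant sectional curvature $K\ge0$, and let $\gamma:I\to N^2$ be a $2s$-harmonic curve parametrized by arc length, where $I\subset\mathbb R$ is an open interval. If the geodesic curvature $\kappa$ of $\gamma$ is constant, then $\kappa=\sqrt{(2s-1)K}$.
   Context: Frenet frame: $T=\gamma'$, and $\mathbf n$ is a smooth unit normal field along $\gamma$ with $\nabla^N_{\gamma'}T=\kappa\,\mathbf n$, $\nabla^N_{\gamma'}\mathbf n=-\kappa T$; $\kappa$ is the geodesic curvature and $\nabla^N$ the Levi-Civita connection. For a smooth curve $\gamma:I\to N$ the tension field is $\tau(\gamma)=\nabla^N_{\gamma'}\gamma'$ and the $k$-energy is $E_k(\gamma)=\frac12\int\|(\nabla^N_{\gamma'})^{k-1}\gamma'\|^2dt$ (this is the specialization to curves of $E_k(\phi)=\frac12\int\|(d+d^* )^k\phi\|^2v_g$). The curve is $k$-harmonic if it is a critical point of $E_k$ under all smooth compactly supported variations (the energy being integrated over a compact set containing the support), the varied curves not being required to be parametrized by arc length.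
   Formalization: If K>0 the curve is assumed not to be a geodesic (geodesics are 2s-harmonic with κ=0, so the claim fails for them); and since the unit normal, hence κ, is fixed only up to sign, the conclusion is |κ|=√((2s−1)K). *)

theory Defs
  imports "HOL-Analysis.Analysis"
begin

section \<open>Smooth maps between open subsets of Euclidean spaces\<close>

text \<open>Only meant for open \<open>S\<close>. Directional derivatives in all directions are again of class
  \<open>C\<^sup>k\<close>; in finite dimension this is the usual \<open>C\<^sup>k\<^sup>+\<^sup>1\<close>.\<close>

primrec Ck_on :: "nat \<Rightarrow> 'b::euclidean_space set \<Rightarrow> ('b \<Rightarrow> 'c::real_normed_vector) \<Rightarrow> bool" where
  "Ck_on 0 S f \<longleftrightarrow> continuous_on S f"
| "Ck_on (Suc k) S f \<longleftrightarrow>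
     (\<forall>x\<in>S. f differentiable (at x)) \<and> (\<forall>v. Ck_on k S (\<lambda>x. frechet_derivative f (at x) v))"

definition smooth_on :: "'b::euclidean_space set \<Rightarrow> ('b \<Rightarrow> 'c::real_normed_vector) \<Rightarrow> bool" where
  "smooth_on S f \<longleftrightarrow> (\<forall>k. Ck_on k S f)"


section \<open>Two-dimensional Riemannian manifolds\<close>

text \<open>A chart is a pair of its domain and its coordinate map. Tensors are represented by their
  coordinate expressions in all charts of an atlas, together with the transformation law; in
  particular \<open>g c x\<close> is the Gram matrix of the metric in the chart \<open>c\<close> at the coordinate point
  \<open>x\<close>.\<close>

type_synonym 'a chart = "'a set \<times> ('a \<Rightarrow> real^2)"
type_synonym 'a metric_family = "'a chart \<Rightarrow> real^2 \<Rightarrow> real^2^2"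

definition dom_of :: "'a chart \<Rightarrow> 'a set" where
  "dom_of c = fst c"

definition coord :: "'a chart \<Rightarrow> 'a \<Rightarrow> real^2" where
  "coord c = snd c"

definition transition :: "'a chart \<Rightarrow> 'a chart \<Rightarrow> real^2 \<Rightarrow> real^2" where
  "transition c c' = coord c' \<circ> inv_into (dom_of c) (coord c)"

definition metric_inner :: "'a metric_family \<Rightarrow> 'a chart \<Rightarrow> real^2 \<Rightarrow> real^2 \<Rightarrow> real^2 \<Rightarrow> real" where
  "metric_inner g c x v w = v \<bullet> (g c x *v w)"

locale riemannian_surface =
  fixes N :: "'a topology" and A :: "'a chart set" and g :: "'a metric_family"
  assumes hausdorff: "Hausdorff_space N"
    and second_countable: "second_countable N"
    and cover: "\<Union>(dom_of ` A) = topspace N"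
    and chart_dom: "c \<in> A \<Longrightarrow> openin N (dom_of c)"
    and chart_image: "c \<in> A \<Longrightarrow> open (coord c ` dom_of c)"
    and chart_homeo: "c \<in> A \<Longrightarrow>
      homeomorphic_map (subtopology N (dom_of c)) (top_of_set (coord c ` dom_of c)) (coord c)"
    and transition_smooth: "c \<in> A \<Longrightarrow> c' \<in> A \<Longrightarrow>
      smooth_on (coord c ` (dom_of c \<inter> dom_of c')) (transition c c')"
    and metric_smooth: "c \<in> A \<Longrightarrow> smooth_on (coord c ` dom_of c) (g c)"
    and metric_symmetric: "c \<in> A \<Longrightarrow> x \<in> coord c ` dom_of c \<Longrightarrow> transpose (g c x) = g c x"
    and metric_positive: "c \<in> A \<Longrightarrow> x \<in> coord c ` dom_of c \<Longrightarrow> v \<noteq> 0 \<Longrightarrow>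
      metric_inner g c x v v > 0"
    and metric_transform: "c \<in> A \<Longrightarrow> c' \<in> A \<Longrightarrow> x \<in> coord c ` (dom_of c \<inter> dom_of c') \<Longrightarrow>
      metric_inner g c x v w =
        metric_inner g c' (transition c c' x)
          (frechet_derivative (transition c c') (at x) v)
          (frechet_derivative (transition c c') (at x) w)"


section \<open>Levi-Civita connection and sectional curvature\<close>

definition partial :: "2 \<Rightarrow> (real^2 \<Rightarrow> real) \<Rightarrow> real^2 \<Rightarrow> real" where
  "partial i f x = frechet_derivative f (at x) (axis i 1)"

text \<open>\<open>christoffel g c k i j x\<close> is the coefficient of \<open>\<partial>\<^sub>k\<close> in \<open>\<nabla>\<close> of \<open>\<partial>\<^sub>j\<close> in direction
  \<open>\<partial>\<^sub>i\<close>.\<close>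

definition christoffel :: "'a metric_family \<Rightarrow> 'a chart \<Rightarrow> 2 \<Rightarrow> 2 \<Rightarrow> 2 \<Rightarrow> real^2 \<Rightarrow> real" where
  "christoffel g c k i j x =
     (\<Sum>l\<in>UNIV. matrix_inv (g c x) $ k $ l *
        (partial i (\<lambda>y. g c y $ j $ l) x + partial j (\<lambda>y. g c y $ i $ l) x
          - partial l (\<lambda>y. g c y $ i $ j) x)) / 2"

text \<open>Sign convention: \<open>R(X,Y)Z = \<nabla>\<^sub>X \<nabla>\<^sub>Y Z - \<nabla>\<^sub>Y \<nabla>\<^sub>X Z - \<nabla>\<^bsub>[X,Y]\<^esub> Z\<close>; \<open>riemann_coeff g c l i j k\<close> is the
  coefficient of \<open>\<partial>\<^sub>l\<close> in \<open>R(\<partial>\<^sub>i,\<partial>\<^sub>j)\<partial>\<^sub>k\<close>.\<close>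

definition riemann_coeff ::
    "'a metric_family \<Rightarrow> 'a chart \<Rightarrow> 2 \<Rightarrow> 2 \<Rightarrow> 2 \<Rightarrow> 2 \<Rightarrow> real^2 \<Rightarrow> real" where
  "riemann_coeff g c l i j k x =
     partial i (christoffel g c l j k) x - partial j (christoffel g c l i k) x
     + (\<Sum>m\<in>UNIV. christoffel g c l i m x * christoffel g c m j k x
                  - christoffel g c l j m x * christoffel g c m i k x)"

definition riemann ::
    "'a metric_family \<Rightarrow> 'a chart \<Rightarrow> real^2 \<Rightarrow> real^2 \<Rightarrow> real^2 \<Rightarrow> real^2 \<Rightarrow> real^2" where
  "riemann g c x X Y Z =
     (\<chi> l. \<Sum>i\<in>UNIV. \<Sum>j\<in>UNIV. \<Sum>k\<in>UNIV. riemann_coeff g c l i j k x * X $ i * Y $ j * Z $ k)"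

definition sectional :: "'a metric_family \<Rightarrow> 'a chart \<Rightarrow> real^2 \<Rightarrow> real^2 \<Rightarrow> real^2 \<Rightarrow> real" where
  "sectional g c x X Y =
     metric_inner g c x (riemann g c x X Y Y) X /
     (metric_inner g c x X X * metric_inner g c x Y Y - (metric_inner g c x X Y)\<^sup>2)"

definition constant_sectional_curvature ::
    "'a chart set \<Rightarrow> 'a metric_family \<Rightarrow> real \<Rightarrow> bool" where
  "constant_sectional_curvature A g K \<longleftrightarrow>
     (\<forall>c\<in>A. \<forall>x \<in> coord c ` dom_of c. \<forall>X Y. X \<noteq> Y \<longrightarrow> independent {X, Y} \<longrightarrow> sectional g c x X Y = K)"


section \<open>Curves and vector fields along curves\<close>

definition smooth_into ::
    "'a topology \<Rightarrow> 'a chart set \<Rightarrow> 'b::euclidean_space set \<Rightarrow> ('b \<Rightarrow> 'a) \<Rightarrow> bool" where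
  "smooth_into N A D f \<longleftrightarrow>
     continuous_map (top_of_set D) N f \<and>
     (\<forall>c\<in>A. smooth_on {x \<in> D. f x \<in> dom_of c} (coord c \<circ> f))"

text \<open>A vector field along a curve \<open>\<gamma>\<close> is given by its coordinate expressions \<open>V c t\<close>, which are
  relevant only for those \<open>t\<close> with \<open>\<gamma> t\<close> in the domain of \<open>c\<close>.\<close>

type_synonym 'a field_along = "'a chart \<Rightarrow> real \<Rightarrow> real^2"

definition smooth_field_along ::
    "'a chart set \<Rightarrow> real set \<Rightarrow> (real \<Rightarrow> 'a) \<Rightarrow> 'a field_along \<Rightarrow> bool" where
  "smooth_field_along A I \<gamma> V \<longleftrightarrow>
     (\<forall>c\<in>A. smooth_on {t \<in> I. \<gamma> t \<in> dom_of c} (V c)) \<and>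
     (\<forall>c\<in>A. \<forall>c'\<in>A. \<forall>t\<in>I. \<gamma> t \<in> dom_of c \<inter> dom_of c' \<longrightarrow>
        V c' t = frechet_derivative (transition c c') (at (coord c (\<gamma> t))) (V c t))"

definition velocity :: "(real \<Rightarrow> 'a) \<Rightarrow> 'a field_along" where
  "velocity \<gamma> c t = vector_derivative (coord c \<circ> \<gamma>) (at t)"

definition cov_deriv ::
    "'a metric_family \<Rightarrow> (real \<Rightarrow> 'a) \<Rightarrow> 'a field_along \<Rightarrow> 'a field_along" where
  "cov_deriv g \<gamma> V c t =
     vector_derivative (V c) (at t) +
     (\<chi> k. \<Sum>i\<in>UNIV. \<Sum>j\<in>UNIV.
        christoffel g c k i j (coord c (\<gamma> t)) * velocity \<gamma> c t $ i * V c t $ j)"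

definition tension :: "'a metric_family \<Rightarrow> (real \<Rightarrow> 'a) \<Rightarrow> 'a field_along" where
  "tension g \<gamma> = cov_deriv g \<gamma> (velocity \<gamma>)"

text \<open>The inner product of two fields along \<open>\<gamma>\<close> does not depend on the chart, so it is computed in
  an arbitrary one.\<close>

definition chart_at :: "'a chart set \<Rightarrow> 'a \<Rightarrow> 'a chart" where
  "chart_at A p = (SOME c. c \<in> A \<and> p \<in> dom_of c)"

definition inner_along ::
    "'a chart set \<Rightarrow> 'a metric_family \<Rightarrow> (real \<Rightarrow> 'a) \<Rightarrow> 'a field_along \<Rightarrow> 'a field_along \<Rightarrow> real \<Rightarrow> real"
  where
  "inner_along A g \<gamma> V W t =
     (let c = chart_at A (\<gamma> t) in metric_inner g c (coord c (\<gamma> t)) (V c t) (W c t))"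

definition fields_eq ::
    "'a chart set \<Rightarrow> real set \<Rightarrow> (real \<Rightarrow> 'a) \<Rightarrow> 'a field_along \<Rightarrow> 'a field_along \<Rightarrow> bool" where
  "fields_eq A I \<gamma> V W \<longleftrightarrow> (\<forall>c\<in>A. \<forall>t\<in>I. \<gamma> t \<in> dom_of c \<longrightarrow> V c t = W c t)"

definition arc_length_parametrized ::
    "'a chart set \<Rightarrow> 'a metric_family \<Rightarrow> real set \<Rightarrow> (real \<Rightarrow> 'a) \<Rightarrow> bool" where
  "arc_length_parametrized A g I \<gamma> \<longleftrightarrow>
     (\<forall>t\<in>I. inner_along A g \<gamma> (velocity \<gamma>) (velocity \<gamma>) t = 1)"

definition geodesic :: "'a chart set \<Rightarrow> 'a metric_family \<Rightarrow> real set \<Rightarrow> (real \<Rightarrow> 'a) \<Rightarrow> bool" where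
  "geodesic A g I \<gamma> \<longleftrightarrow> fields_eq A I \<gamma> (tension g \<gamma>) (\<lambda>c t. 0)"

text \<open>The normal \<open>n\<close> is determined up to sign only, and so is the geodesic curvature \<open>\<kappa>\<close>.\<close>

definition frenet ::
    "'a chart set \<Rightarrow> 'a metric_family \<Rightarrow> real set \<Rightarrow> (real \<Rightarrow> 'a) \<Rightarrow> 'a field_along \<Rightarrow> (real \<Rightarrow> real) \<Rightarrow> bool"
  where
  "frenet A g I \<gamma> n \<kappa> \<longleftrightarrow>
     smooth_field_along A I \<gamma> n \<and>
     (\<forall>t\<in>I. inner_along A g \<gamma> n n t = 1 \<and> inner_along A g \<gamma> n (velocity \<gamma>) t = 0) \<and>
     fields_eq A I \<gamma> (cov_deriv g \<gamma> (velocity \<gamma>)) (\<lambda>c t. \<kappa> t *\<^sub>R n c t) \<and>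
     fields_eq A I \<gamma> (cov_deriv g \<gamma> n) (\<lambda>c t. - \<kappa> t *\<^sub>R velocity \<gamma> c t)"


section \<open>The \<open>k\<close>-energy and \<open>k\<close>-harmonic curves\<close>

text \<open>Used for \<open>k \<ge> 1\<close> only.\<close>

definition k_energy ::
    "'a chart set \<Rightarrow> 'a metric_family \<Rightarrow> nat \<Rightarrow> real set \<Rightarrow> (real \<Rightarrow> 'a) \<Rightarrow> real" where
  "k_energy A g k C \<gamma> =
     (let V = (cov_deriv g \<gamma> ^^ (k - 1)) (velocity \<gamma>) in
      integral C (\<lambda>t. inner_along A g \<gamma> V V t) / 2)"

text \<open>A smooth variation \<open>\<Gamma> (u, t)\<close>, \<open>\<bar>u\<bar> < \<epsilon>\<close>, of \<open>\<gamma>\<close> with support in the compact set \<open>C\<close>.\<close>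

definition variation ::
    "'a topology \<Rightarrow> 'a chart set \<Rightarrow> real set \<Rightarrow> (real \<Rightarrow> 'a) \<Rightarrow> real set \<Rightarrow> real \<Rightarrow> (real \<times> real \<Rightarrow> 'a) \<Rightarrow> bool"
  where
  "variation N A I \<gamma> C \<epsilon> \<Gamma> \<longleftrightarrow>
     compact C \<and> C \<subseteq> I \<and> \<epsilon> > 0 \<and>
     smooth_into N A ({-\<epsilon><..<\<epsilon>} \<times> I) \<Gamma> \<and>
     (\<forall>t\<in>I. \<Gamma> (0, t) = \<gamma> t) \<and>
     (\<forall>u\<in>{-\<epsilon><..<\<epsilon>}. \<forall>t\<in>I - C. \<Gamma> (u, t) = \<gamma> t)"

definition k_harmonic ::
    "'a topology \<Rightarrow> 'a chart set \<Rightarrow> 'a metric_family \<Rightarrow> nat \<Rightarrow> real set \<Rightarrow> (real \<Rightarrow> 'a) \<Rightarrow> bool" where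
  "k_harmonic N A g k I \<gamma> \<longleftrightarrow>
     smooth_into N A I \<gamma> \<and>
     (\<forall>C \<epsilon> \<Gamma>. variation N A I \<gamma> C \<epsilon> \<Gamma> \<longrightarrow>
        ((\<lambda>u. k_energy A g k C (\<lambda>t. \<Gamma> (u, t))) has_real_derivative 0) (at 0))"

end

theory Submission
  imports Defs
begin

text \<open>
  Deform \<open>\<gamma>\<close> in its normal direction by \<open>u \<phi> \<nu>\<close>, where \<open>\<phi>\<close> is a bump function supported in one
  chart. With \<open>W\<^sub>j = \<nabla>\<^sub>t\<^sup>j T\<close>, the commutator \<open>\<nabla>\<^sub>u \<nabla>\<^sub>t = \<nabla>\<^sub>t \<nabla>\<^sub>u + R(\<partial>\<^sub>u, \<partial>\<^sub>t)\<close> gives a recursion for \<open>\<nabla>\<^sub>u W\<^sub>j\<close>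
  along \<open>\<gamma>\<close>. In the frame \<open>(T, \<nu>)\<close>, identified with the complex plane, \<open>W\<^sub>j = (\<i> k)\<^sup>j\<close> and
  \<open>\<nabla>\<^sub>u W\<^sub>j = z\<^sub>j\<close> with \<open>z\<^sub>0 = \<i> \<phi>' - k \<phi>\<close> and \<open>z\<^sub>j\<^sub>+\<^sub>1 = z\<^sub>j' + \<i> k z\<^sub>j + \<i> K \<phi> (\<i> k)\<^sup>j\<close>. Integrals of
  derivatives vanish, so the integral of \<open>z\<^sub>m\<close> is \<open>(m K - k\<^sup>2) (\<i> k)\<^sup>m / k\<close> times that of \<open>\<phi>\<close>,
  and the first variation of \<open>E\<^sub>m\<^sub>+\<^sub>1\<close> vanishes only if \<open>k\<^sup>2 = m K\<close>.
\<close>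

section \<open>Calculus of smooth maps\<close>

text \<open>The full Euler-Lagrange equation of the energy is not derived. As \<open>k\<close> is
  constant, \<open>W\<^sub>m\<close> has constant components in the frame, so pairing it with the
  variation tests only the integral of \<open>z\<^sub>m\<close>, and one bump near one point yields
  the necessary condition. The integer \<open>m\<close>, which is 2s - 1 for the energy of order 2s,
  counts the commutations of the two covariant derivatives: each contributes one \<open>K\<close>,
  while \<open>z\<^sub>0\<close> contributes the term with the square of \<open>k\<close>. Two
  obstacles shape the development. The energy is defined through coordinate expressions in
  arbitrarily chosen charts, so a computation in one chart presupposes the transformation law of the
  connection and of iterated covariant derivatives. Moreover \<open>cov_deriv\<close> differentiates
  along a single curve, whereas commuting derivatives needs fields that depend on both parameters;
  these are handled in coordinates by \<open>cov_dir\<close>.\<close>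

lemma frechet_derivative_eqI:
  "(f has_derivative f') (at x) \<Longrightarrow> frechet_derivative f (at x) = f'"
  using frechet_derivative_at by metis

lemma linear_frechet: "f differentiable at x \<Longrightarrow> linear (frechet_derivative f (at x))"
  by (simp add: linear_frechet_derivative)

lemma Ck_on_cong:
  assumes "open S" "\<And>x. x \<in> S \<Longrightarrow> f x = h x" "Ck_on k S f"
  shows "Ck_on k S h"
  using assms(2,3)
proof (induction k arbitrary: f h)
  case 0
  then show ?case using continuous_on_cong by fastforce
next
  case (Suc k)
  have *: "(h has_derivative frechet_derivative f (at x)) (at x)" if "x \<in> S" for x
    using Suc.prems that assms(1)
    by (auto intro!: has_derivative_transform_within_open[of f _ x UNIV S h]
        simp: frechet_derivative_works)
  have "Ck_on k S (\<lambda>x. frechet_derivative h (at x) v)" for v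
    by (rule Suc.IH[of "\<lambda>x. frechet_derivative f (at x) v"])
      (use Suc.prems frechet_derivative_eqI[OF *] in auto)
  then show ?case using * by (auto simp: differentiable_def)
qed

lemma Ck_on_Suc_imp_Ck_on: "Ck_on (Suc k) S f \<Longrightarrow> Ck_on k S f"
proof (induction k arbitrary: f)
  case 0
  then show ?case
    by (auto intro!: continuous_at_imp_continuous_on differentiable_imp_continuous_within)
next
  case (Suc k)
  then show ?case by (auto simp del: Ck_on.simps(1))
qed

lemma Ck_on_subset: "Ck_on k S f \<Longrightarrow> T \<subseteq> S \<Longrightarrow> Ck_on k T f"
proof (induction k arbitrary: f)
  case 0
  then show ?case by (auto intro: continuous_on_subset)
next
  case (Suc k)
  then show ?case by auto
qed

text \<open>Derivatives are taken \<open>at x\<close> in the whole space, so they see only a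
  neighbourhood of each point. This is how a variation given by different formulas on two open sets
  is recognised as smooth.\<close>

lemma Ck_on_local:
  assumes "\<And>x. x \<in> S \<Longrightarrow> \<exists>U. open U \<and> x \<in> U \<and> U \<subseteq> S \<and> Ck_on k U f"
  shows "Ck_on k S f"
  using assms
proof (induction k arbitrary: f)
  case 0
  show ?case
  proof (simp, rule continuous_at_imp_continuous_on, rule ballI)
    fix x assume "x \<in> S"
    then show "continuous (at x) f"
      using 0 continuous_on_eq_continuous_at by fastforce
  qed
next
  case (Suc k)
  have "Ck_on k S (\<lambda>x. frechet_derivative f (at x) v)" for v
    by (rule Suc.IH) (use Suc.prems in fastforce)
  moreover have "\<forall>x\<in>S. f differentiable at x" using Suc.prems by fastforce
  ultimately show ?case by simp
qed

lemma smooth_on_unfold: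
  "smooth_on S f \<longleftrightarrow>
    (\<forall>x\<in>S. f differentiable (at x)) \<and> (\<forall>v. smooth_on S (\<lambda>x. frechet_derivative f (at x) v))"
proof
  assume "smooth_on S f"
  then have "Ck_on (Suc k) S f" for k unfolding smooth_on_def by blast
  then show "(\<forall>x\<in>S. f differentiable (at x)) \<and> (\<forall>v. smooth_on S (\<lambda>x. frechet_derivative f (at x) v))"
    unfolding smooth_on_def by auto
next
  assume *: "(\<forall>x\<in>S. f differentiable (at x)) \<and> (\<forall>v. smooth_on S (\<lambda>x. frechet_derivative f (at x) v))"
  then have "Ck_on (Suc k) S f" for k unfolding smooth_on_def by auto
  then have "Ck_on k S f" for k by (rule Ck_on_Suc_imp_Ck_on)
  then show "smooth_on S f" by (simp add: smooth_on_def)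
qed

lemma smooth_on_differentiable: "smooth_on S f \<Longrightarrow> x \<in> S \<Longrightarrow> f differentiable (at x)"
  by (simp add: smooth_on_unfold[of S f])

lemma smooth_on_has_derivative:
  "smooth_on S f \<Longrightarrow> x \<in> S \<Longrightarrow> (f has_derivative frechet_derivative f (at x)) (at x)"
  by (simp add: smooth_on_differentiable frechet_derivative_works[symmetric])

lemma smooth_on_frechet: "smooth_on S f \<Longrightarrow> smooth_on S (\<lambda>x. frechet_derivative f (at x) v)"
  by (simp add: smooth_on_unfold[of S f])

lemma smooth_on_continuous_on: "smooth_on S f \<Longrightarrow> continuous_on S f"
  unfolding smooth_on_def by (drule spec[of _ 0]) simp

lemma smooth_on_cong:
  "open S \<Longrightarrow> (\<And>x. x \<in> S \<Longrightarrow> f x = h x) \<Longrightarrow> smooth_on S f \<Longrightarrow> smooth_on S h"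
  unfolding smooth_on_def by (rule allI, rule Ck_on_cong) (assumption | erule spec | simp)+

lemma smooth_on_subset: "smooth_on S f \<Longrightarrow> T \<subseteq> S \<Longrightarrow> smooth_on T f"
  unfolding smooth_on_def by (rule allI, rule Ck_on_subset) (assumption | erule spec)+

lemma smooth_on_local:
  assumes "\<And>x. x \<in> S \<Longrightarrow> \<exists>U. open U \<and> x \<in> U \<and> U \<subseteq> S \<and> smooth_on U f"
  shows "smooth_on S f"
  unfolding smooth_on_def
proof
  fix k show "Ck_on k S f"
  proof (rule Ck_on_local)
    fix x assume "x \<in> S"
    then obtain U where "open U" "x \<in> U" "U \<subseteq> S" "smooth_on U f" using assms by auto
    then show "\<exists>U. open U \<and> x \<in> U \<and> U \<subseteq> S \<and> Ck_on k U f"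
      by (auto simp: smooth_on_def)
  qed
qed

section \<open>Closure properties of smooth maps\<close>

lemma Ck_on_const: "Ck_on k S (\<lambda>x. c)"
  by (induction k arbitrary: c) auto

lemma smooth_on_const: "smooth_on S (\<lambda>x. c)"
  by (simp add: smooth_on_def Ck_on_const)

lemma Ck_on_bounded_linear:
  assumes "open S" "bounded_linear L" "Ck_on k S f"
  shows "Ck_on k S (\<lambda>x. L (f x))"
  using assms(3)
proof (induction k arbitrary: f)
  case 0
  then show ?case using assms(2) by (auto intro: bounded_linear.continuous_on)
next
  case (Suc k)
  have *: "((\<lambda>x. L (f x)) has_derivative (\<lambda>v. L (frechet_derivative f (at x) v))) (at x)" if "x \<in> S" for x
    using Suc.prems that
    by (auto intro!: bounded_linear.has_derivative[OF assms(2)] simp: frechet_derivative_works)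
  have "Ck_on k S (\<lambda>x. frechet_derivative (\<lambda>x. L (f x)) (at x) v)" for v
    by (rule Ck_on_cong[OF assms(1) _ Suc.IH[of "\<lambda>x. frechet_derivative f (at x) v"]])
      (use Suc.prems frechet_derivative_eqI[OF *] in auto)
  then show ?case using * by (auto simp: differentiable_def)
qed

lemma smooth_on_bounded_linear:
  "open S \<Longrightarrow> bounded_linear L \<Longrightarrow> smooth_on S f \<Longrightarrow> smooth_on S (\<lambda>x. L (f x))"
  unfolding smooth_on_def by (rule allI, rule Ck_on_bounded_linear) simp_all

lemma smooth_on_linear:
  fixes L :: "'b::euclidean_space \<Rightarrow> 'c::real_normed_vector"
  assumes "open S" "bounded_linear L"
  shows "smooth_on S L"
proof -
  have "L differentiable at x" "frechet_derivative L (at x) = L" for x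
    using bounded_linear_imp_has_derivative[OF assms(2)] frechet_derivative_eqI
    by (auto simp: differentiable_def)
  then show ?thesis
    by (subst smooth_on_unfold) (auto simp: smooth_on_const)
qed

lemma Ck_on_add:
  assumes "open S" "Ck_on k S f" "Ck_on k S h"
  shows "Ck_on k S (\<lambda>x. f x + h x)"
  using assms(2,3)
proof (induction k arbitrary: f h)
  case 0
  then show ?case by (auto intro: continuous_on_add)
next
  case (Suc k)
  have *: "((\<lambda>x. f x + h x) has_derivative
      (\<lambda>v. frechet_derivative f (at x) v + frechet_derivative h (at x) v)) (at x)" if "x \<in> S" for x
    using Suc.prems that
    by (auto intro!: has_derivative_add simp: frechet_derivative_works)
  have "Ck_on k S (\<lambda>x. frechet_derivative (\<lambda>x. f x + h x) (at x) v)" for v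
    by (rule Ck_on_cong[OF assms(1) _ Suc.IH[of "\<lambda>x. frechet_derivative f (at x) v"
        "\<lambda>x. frechet_derivative h (at x) v"]])
      (use Suc.prems frechet_derivative_eqI[OF *] in auto)
  then show ?case using * by (auto simp: differentiable_def)
qed

lemma smooth_on_add:
  "open S \<Longrightarrow> smooth_on S f \<Longrightarrow> smooth_on S h \<Longrightarrow> smooth_on S (\<lambda>x. f x + h x)"
  unfolding smooth_on_def by (rule allI, rule Ck_on_add) simp_all

lemma smooth_on_minus: "open S \<Longrightarrow> smooth_on S f \<Longrightarrow> smooth_on S (\<lambda>x. - f x)"
  by (rule smooth_on_bounded_linear[OF _ bounded_linear_minus[OF bounded_linear_ident]])

lemma smooth_on_diff:
  "open S \<Longrightarrow> smooth_on S f \<Longrightarrow> smooth_on S h \<Longrightarrow> smooth_on S (\<lambda>x. f x - h x)"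
  using smooth_on_add[of S f "\<lambda>x. - h x"] smooth_on_minus[of S h] by simp

lemma Ck_on_sum:
  "open S \<Longrightarrow> (\<And>i. i \<in> F \<Longrightarrow> Ck_on k S (f i)) \<Longrightarrow> Ck_on k S (\<lambda>x. \<Sum>i\<in>F. f i x)"
proof (induction F rule: infinite_finite_induct)
  case (insert i F)
  then show ?case by (simp add: Ck_on_add)
qed (simp_all add: Ck_on_const)

lemma smooth_on_sum:
  "open S \<Longrightarrow> (\<And>i. i \<in> F \<Longrightarrow> smooth_on S (f i)) \<Longrightarrow> smooth_on S (\<lambda>x. \<Sum>i\<in>F. f i x)"
  unfolding smooth_on_def by (rule allI, rule Ck_on_sum) simp_all

lemma Ck_on_bilinear:
  assumes "open S" "bounded_bilinear B" "Ck_on k S f" "Ck_on k S h"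
  shows "Ck_on k S (\<lambda>x. B (f x) (h x))"
  using assms(3,4)
proof (induction k arbitrary: f h)
  case 0
  then show ?case using bounded_bilinear.continuous_on[OF assms(2)] by auto
next
  case (Suc k)
  have *: "((\<lambda>x. B (f x) (h x)) has_derivative
      (\<lambda>v. B (f x) (frechet_derivative h (at x) v) + B (frechet_derivative f (at x) v) (h x))) (at x)"
    if "x \<in> S" for x
    using Suc.prems that
    by (auto intro!: bounded_bilinear.FDERIV[OF assms(2)] simp: frechet_derivative_works)
  have fh: "Ck_on k S f" "Ck_on k S h" using Suc.prems[THEN Ck_on_Suc_imp_Ck_on] by simp_all
  have "Ck_on k S (\<lambda>x. frechet_derivative (\<lambda>x. B (f x) (h x)) (at x) v)" for v
    by (rule Ck_on_cong[OF assms(1) _ Ck_on_add[OF assms(1) Suc.IH[of f "\<lambda>x. frechet_derivative h (at x) v"]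
            Suc.IH[of "\<lambda>x. frechet_derivative f (at x) v" h]]])
      (use Suc.prems frechet_derivative_eqI[OF *] fh in auto)
  then show ?case using * by (auto simp: differentiable_def)
qed

lemma smooth_on_bilinear:
  "open S \<Longrightarrow> bounded_bilinear B \<Longrightarrow> smooth_on S f \<Longrightarrow> smooth_on S h \<Longrightarrow>
    smooth_on S (\<lambda>x. B (f x) (h x))"
  unfolding smooth_on_def by (rule allI, rule Ck_on_bilinear) simp_all

lemmas smooth_on_mult = smooth_on_bilinear[OF _ bounded_bilinear_mult]
  and smooth_on_scaleR = smooth_on_bilinear[OF _ bounded_bilinear_scaleR]
  and smooth_on_inner = smooth_on_bilinear[OF _ bounded_bilinear_inner]

text \<open>The derivative contains the inverse again, but undifferentiated, so the induction
  closes.\<close>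

lemma Ck_on_inverse:
  fixes f :: "'b::euclidean_space \<Rightarrow> real"
  assumes "open S" "\<And>x. x \<in> S \<Longrightarrow> f x \<noteq> 0" "Ck_on k S f"
  shows "Ck_on k S (\<lambda>x. inverse (f x))"
  using assms(3)
proof (induction k)
  case 0
  then show ?case using assms(2) by (auto intro: continuous_on_inverse)
next
  case (Suc k)
  note bm = Ck_on_bilinear[OF assms(1) bounded_bilinear_mult]
  have *: "((\<lambda>x. inverse (f x)) has_derivative
      (\<lambda>v. - (inverse (f x) * frechet_derivative f (at x) v * inverse (f x)))) (at x)"
    if "x \<in> S" for x
    using Suc.prems that assms(2)
    by (auto intro!: has_derivative_inverse simp: frechet_derivative_works)
  have I: "Ck_on k S (\<lambda>x. inverse (f x))"
    by (rule Suc.IH[OF Ck_on_Suc_imp_Ck_on[OF Suc.prems]])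
  have "Ck_on k S (\<lambda>x. frechet_derivative (\<lambda>x. inverse (f x)) (at x) v)" for v
  proof (rule Ck_on_cong[OF assms(1)])
    show "Ck_on k S (\<lambda>x. - (inverse (f x) * frechet_derivative f (at x) v * inverse (f x)))"
      by (rule Ck_on_bounded_linear[OF assms(1) bounded_linear_minus[OF bounded_linear_ident]])
        (intro bm I, use Suc.prems in simp)
  qed (use frechet_derivative_eqI[OF *] in auto)
  then show ?case using * by (auto simp: differentiable_def)
qed

lemma smooth_on_inverse:
  fixes f :: "'b::euclidean_space \<Rightarrow> real"
  shows "open S \<Longrightarrow> (\<And>x. x \<in> S \<Longrightarrow> f x \<noteq> 0) \<Longrightarrow> smooth_on S f \<Longrightarrow> smooth_on S (\<lambda>x. inverse (f x))"
  unfolding smooth_on_def by (rule allI, rule Ck_on_inverse) simp_all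

text \<open>\<open>Ck_on\<close> controls derivatives in fixed directions, while the chain rule
  applies the derivative of \<open>f\<close> to a direction that moves with \<open>x\<close>.
  Expanding that direction in the basis leaves scalar coefficients times derivatives of
  \<open>f\<close> in fixed directions, to which the induction hypothesis applies.\<close>

lemma Ck_on_compose:
  fixes h :: "'b::euclidean_space \<Rightarrow> 'c::euclidean_space"
  assumes "open S" "h ` S \<subseteq> T" "Ck_on k T f" "Ck_on k S h"
  shows "Ck_on k S (\<lambda>x. f (h x))"
  using assms(3,4)
proof (induction k arbitrary: f)
  case 0
  then show ?case using assms(2) by (auto intro: continuous_on_compose2)
next
  case (Suc k)
  have *: "((\<lambda>x. f (h x)) has_derivative
      (\<lambda>v. frechet_derivative f (at (h x)) (frechet_derivative h (at x) v))) (at x)"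
    if "x \<in> S" for x
    using Suc.prems that assms(2)
    by (intro has_derivative_compose[where f = h and g = f]) (auto simp: frechet_derivative_works)
  have "Ck_on k S (\<lambda>x. frechet_derivative (\<lambda>x. f (h x)) (at x) v)" for v
  proof (rule Ck_on_cong[OF assms(1)])
    show "Ck_on k S (\<lambda>x. \<Sum>b\<in>Basis. (frechet_derivative h (at x) v \<bullet> b) *\<^sub>R frechet_derivative f (at (h x)) b)"
    proof (intro Ck_on_sum Ck_on_bilinear[OF _ bounded_bilinear_scaleR] assms(1))
      fix b :: 'c assume "b \<in> Basis"
      show "Ck_on k S (\<lambda>x. frechet_derivative f (at (h x)) b)"
        by (rule Suc.IH) (use Suc.prems(1) Ck_on_Suc_imp_Ck_on[OF Suc.prems(2)] in simp_all)
      show "Ck_on k S (\<lambda>x. frechet_derivative h (at x) v \<bullet> b)"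
        by (rule Ck_on_bounded_linear[OF assms(1) bounded_linear_inner_left]) (use Suc.prems in auto)
    qed
    fix x assume x: "x \<in> S"
    then have "f differentiable at (h x)" using Suc.prems assms(2) by auto
    then have L: "linear (frechet_derivative f (at (h x)))" by (rule linear_frechet)
    show "(\<Sum>b\<in>Basis. (frechet_derivative h (at x) v \<bullet> b) *\<^sub>R frechet_derivative f (at (h x)) b) =
        frechet_derivative (\<lambda>x. f (h x)) (at x) v"
      unfolding frechet_derivative_eqI[OF *[OF x]]
      by (subst (2) euclidean_representation[symmetric])
        (simp add: linear_sum[OF L] linear_scale[OF L])
  qed
  then show ?case using * by (auto simp: differentiable_def)
qed

lemma smooth_on_compose:
  fixes h :: "'b::euclidean_space \<Rightarrow> 'c::euclidean_space"
  shows "open S \<Longrightarrow> h ` S \<subseteq> T \<Longrightarrow> smooth_on T f \<Longrightarrow> smooth_on S h \<Longrightarrow> smooth_on S (\<lambda>x. f (h x))"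
  unfolding smooth_on_def by (rule allI, rule Ck_on_compose) (assumption | erule spec)+

lemma smooth_on_vec:
  fixes f :: "'b::euclidean_space \<Rightarrow> real^'n"
  assumes "open S" "\<And>i. smooth_on S (\<lambda>x. f x $ i)"
  shows "smooth_on S f"
proof (rule smooth_on_cong[OF assms(1)])
  show "smooth_on S (\<lambda>x. \<Sum>i\<in>UNIV. f x $ i *\<^sub>R axis i 1)"
    by (intro smooth_on_sum smooth_on_scaleR smooth_on_const assms)
qed (simp add: vec_eq_iff axis_def if_distrib cong: if_cong)

lemma smooth_on_nth: "open S \<Longrightarrow> smooth_on S f \<Longrightarrow> smooth_on S (\<lambda>x. f x $ i)"
  by (rule smooth_on_bounded_linear[OF _ bounded_linear_vec_nth])

lemma smooth_on_vector_derivative: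
  fixes f :: "real \<Rightarrow> 'c::real_normed_vector"
  assumes "open S" "smooth_on S f"
  shows "smooth_on S (\<lambda>t. vector_derivative f (at t))"
proof (rule smooth_on_cong[OF assms(1) _ smooth_on_frechet[OF assms(2), of 1]])
  fix x assume "x \<in> S"
  then show "frechet_derivative f (at x) 1 = vector_derivative f (at x)"
    using smooth_on_differentiable[OF assms(2)]
    by (simp add: frechet_derivative_eq_vector_derivative)
qed

lemma smooth_on_has_vector_derivative:
  fixes f :: "real \<Rightarrow> 'c::real_normed_vector"
  assumes "smooth_on S f" "t \<in> S"
  shows "(f has_vector_derivative vector_derivative f (at t)) (at t)"
  using smooth_on_differentiable[OF assms] by (simp add: vector_derivative_works)

text \<open>The mean value theorem is applied twice: in direction \<open>v\<close> to the increment
  of \<open>f\<close> over \<open>e *\<^sub>R w\<close>, then in direction \<open>w\<close> to the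
  derivative of \<open>f\<close> along \<open>v\<close>.\<close>

lemma second_difference_mean_value:
  fixes f :: "'b::euclidean_space \<Rightarrow> real"
  assumes "smooth_on S f" "e > 0"
    and in_S: "\<And>s r. 0 \<le> s \<Longrightarrow> s \<le> e \<Longrightarrow> 0 \<le> r \<Longrightarrow> r \<le> e \<Longrightarrow> x + s *\<^sub>R v + r *\<^sub>R w \<in> S"
  shows "\<exists>s r. 0 < s \<and> s < e \<and> 0 < r \<and> r < e \<and>
    f (x + e *\<^sub>R v + e *\<^sub>R w) - f (x + e *\<^sub>R v) - f (x + e *\<^sub>R w) + f x =
    e\<^sup>2 * frechet_derivative (\<lambda>y. frechet_derivative f (at y) v) (at (x + s *\<^sub>R v + r *\<^sub>R w)) w"
proof -
  define fv where "fv = (\<lambda>y. frechet_derivative f (at y) v)"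
  define ph where "ph s = f (x + s *\<^sub>R v + e *\<^sub>R w) - f (x + s *\<^sub>R v)" for s
  have *: "((\<lambda>s. f (x + s *\<^sub>R v + r *\<^sub>R w)) has_real_derivative fv (x + s *\<^sub>R v + r *\<^sub>R w)) (at s)"
    if "0 \<le> s" "s \<le> e" "0 \<le> r" "r \<le> e" for s r
  proof -
    have "((\<lambda>s. f (x + s *\<^sub>R v + r *\<^sub>R w)) has_derivative
        (\<lambda>h. frechet_derivative f (at (x + s *\<^sub>R v + r *\<^sub>R w)) (h *\<^sub>R v))) (at s)"
      by (rule has_derivative_compose[where f = "\<lambda>s. x + s *\<^sub>R v + r *\<^sub>R w" and g = f,
            OF _ smooth_on_has_derivative[OF assms(1) in_S[OF that]]])
        (auto intro!: derivative_eq_intros)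
    moreover have "frechet_derivative f (at (x + s *\<^sub>R v + r *\<^sub>R w)) (h *\<^sub>R v) =
        h * fv (x + s *\<^sub>R v + r *\<^sub>R w)" for h
      using linear_scale[OF linear_frechet[OF smooth_on_differentiable[OF assms(1) in_S[OF that]]]]
      by (simp add: fv_def)
    ultimately show ?thesis
      by (simp add: has_field_derivative_def mult.commute[of _ "fv _"] fun_eq_iff)
  qed
  have "(ph has_real_derivative (fv (x + s *\<^sub>R v + e *\<^sub>R w) - fv (x + s *\<^sub>R v))) (at s)"
    if "0 \<le> s" "s \<le> e" for s
    unfolding ph_def using *[OF that, of e] *[OF that, of 0] \<open>e > 0\<close>
    by (auto intro!: derivative_intros)
  then obtain s where s: "0 < s" "s < e"
      "ph e - ph 0 = (e - 0) * (fv (x + s *\<^sub>R v + e *\<^sub>R w) - fv (x + s *\<^sub>R v))"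
    using MVT2[of 0 e ph "\<lambda>s. fv (x + s *\<^sub>R v + e *\<^sub>R w) - fv (x + s *\<^sub>R v)"] \<open>e > 0\<close> by auto
  have sm: "smooth_on S fv" unfolding fv_def by (rule smooth_on_frechet[OF assms(1)])
  have "((\<lambda>r. fv (x + s *\<^sub>R v + r *\<^sub>R w)) has_real_derivative
      frechet_derivative fv (at (x + s *\<^sub>R v + r *\<^sub>R w)) w) (at r)"
    if "0 \<le> r" "r \<le> e" for r
  proof -
    have i: "x + s *\<^sub>R v + r *\<^sub>R w \<in> S" using in_S s that by auto
    have "((\<lambda>r. fv (x + s *\<^sub>R v + r *\<^sub>R w)) has_derivative
        (\<lambda>h. frechet_derivative fv (at (x + s *\<^sub>R v + r *\<^sub>R w)) (h *\<^sub>R w))) (at r)"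
      by (rule has_derivative_compose[where f = "\<lambda>r. x + s *\<^sub>R v + r *\<^sub>R w" and g = fv,
            OF _ smooth_on_has_derivative[OF sm i]])
        (auto intro!: derivative_eq_intros)
    moreover have "frechet_derivative fv (at (x + s *\<^sub>R v + r *\<^sub>R w)) (h *\<^sub>R w) =
        h * frechet_derivative fv (at (x + s *\<^sub>R v + r *\<^sub>R w)) w" for h
      using linear_scale[OF linear_frechet[OF smooth_on_differentiable[OF sm i]]] by simp
    ultimately show ?thesis
      unfolding has_field_derivative_def
      by (auto elim!: has_derivative_eq_rhs simp: fun_eq_iff mult.commute)
  qed
  then obtain r where r: "0 < r" "r < e"
      "fv (x + s *\<^sub>R v + e *\<^sub>R w) - fv (x + s *\<^sub>R v + 0 *\<^sub>R w) =
        (e - 0) * frechet_derivative fv (at (x + s *\<^sub>R v + r *\<^sub>R w)) w"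
    using MVT2[of 0 e "\<lambda>r. fv (x + s *\<^sub>R v + r *\<^sub>R w)"
        "\<lambda>r. frechet_derivative fv (at (x + s *\<^sub>R v + r *\<^sub>R w)) w"] \<open>e > 0\<close> by auto
  have "ph e - ph 0 = e\<^sup>2 * frechet_derivative fv (at (x + s *\<^sub>R v + r *\<^sub>R w)) w"
    using s r by (simp add: power2_eq_square)
  moreover have "ph e - ph 0 = f (x + e *\<^sub>R v + e *\<^sub>R w) - f (x + e *\<^sub>R v) - f (x + e *\<^sub>R w) + f x"
    by (simp add: ph_def)
  ultimately show ?thesis using s r unfolding fv_def by (intro exI[of _ s] exI[of _ r]) simp
qed

text \<open>The second difference is symmetric in \<open>v\<close> and \<open>w\<close>, so the two
  iterated derivatives agree at points of shrinking parallelograms; continuity carries the equality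
  to \<open>x\<close>.\<close>

lemma second_derivative_symmetric_real:
  fixes f :: "'b::euclidean_space \<Rightarrow> real"
  assumes "open S" "smooth_on S f" "x \<in> S"
  shows "frechet_derivative (\<lambda>y. frechet_derivative f (at y) v) (at x) w =
    frechet_derivative (\<lambda>y. frechet_derivative f (at y) w) (at x) v"
proof -
  let ?D = "\<lambda>v w y. frechet_derivative (\<lambda>y. frechet_derivative f (at y) v) (at y) w"
  obtain d where d: "d > 0" "ball x d \<subseteq> S" using assms openE by blast
  \<comment> \<open>The steps tend to 0 and keep every parallelogram inside \<open>ball x d\<close>;
    the summand 1 covers vanishing \<open>v\<close> and \<open>w\<close>, and halving gives a strict
    bound.\<close>
  define e where "e n = d / ((norm v + norm w + 1) * real (Suc n)) / 2" for n
  have pos: "norm v + norm w + 1 > 0" by (simp add: add_nonneg_pos)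
  have e_pos: "e n > 0" for n using d pos by (simp add: e_def)
  have bound: "e n * (norm v + norm w) < d" for n
  proof -
    have "e n * (norm v + norm w) \<le> e n * (norm v + norm w + 1)"
      using e_pos[of n] by simp
    also have "\<dots> = d / real (Suc n) / 2" using pos by (simp add: e_def)
    also have "\<dots> \<le> d / 2" using d by (simp add: divide_le_eq)
    also have "\<dots> < d" using d by simp
    finally show ?thesis .
  qed
  have in_S: "x + s *\<^sub>R v + r *\<^sub>R w \<in> S" if "0 \<le> s" "s \<le> e n" "0 \<le> r" "r \<le> e n" for s r n
  proof -
    have "norm (s *\<^sub>R v + r *\<^sub>R w) \<le> s * norm v + r * norm w"
      using norm_triangle_ineq[of "s *\<^sub>R v" "r *\<^sub>R w"] that by simp
    also have "\<dots> \<le> e n * (norm v + norm w)"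
      using that by (simp add: distrib_left add_mono mult_right_mono)
    also have "\<dots> < d" by (rule bound)
    finally have "x + (s *\<^sub>R v + r *\<^sub>R w) \<in> ball x d"
      using dist_add_cancel[of x 0 "s *\<^sub>R v + r *\<^sub>R w"] by simp
    then show ?thesis using d(2) by (auto simp: add.assoc)
  qed
  have in_S': "x + s *\<^sub>R w + r *\<^sub>R v \<in> S" if "0 \<le> s" "s \<le> e n" "0 \<le> r" "r \<le> e n" for s r n
    using in_S[of r n s] that by (simp add: add_ac)
  have "\<forall>n. \<exists>s r s' r'. 0 < s \<and> s < e n \<and> 0 < r \<and> r < e n \<and> 0 < s' \<and> s' < e n \<and> 0 < r' \<and> r' < e n \<and>
    ?D v w (x + s *\<^sub>R v + r *\<^sub>R w) = ?D w v (x + s' *\<^sub>R w + r' *\<^sub>R v)"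
  proof
    fix n
    obtain s r where 1: "0 < s" "s < e n" "0 < r" "r < e n"
      "f (x + e n *\<^sub>R v + e n *\<^sub>R w) - f (x + e n *\<^sub>R v) - f (x + e n *\<^sub>R w) + f x =
        (e n)\<^sup>2 * ?D v w (x + s *\<^sub>R v + r *\<^sub>R w)"
      using second_difference_mean_value[OF assms(2) e_pos[of n] in_S[where n = n]] by auto
    obtain s' r' where 2: "0 < s'" "s' < e n" "0 < r'" "r' < e n"
      "f (x + e n *\<^sub>R w + e n *\<^sub>R v) - f (x + e n *\<^sub>R w) - f (x + e n *\<^sub>R v) + f x =
        (e n)\<^sup>2 * ?D w v (x + s' *\<^sub>R w + r' *\<^sub>R v)"
      using second_difference_mean_value[OF assms(2) e_pos[of n] in_S'[where n = n]] by auto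
    have "(e n)\<^sup>2 * ?D v w (x + s *\<^sub>R v + r *\<^sub>R w) = (e n)\<^sup>2 * ?D w v (x + s' *\<^sub>R w + r' *\<^sub>R v)"
      using 1(5) 2(5) by (simp only: add.assoc add.commute[of "e n *\<^sub>R w" "e n *\<^sub>R v"])
    then show "\<exists>s r s' r'. 0 < s \<and> s < e n \<and> 0 < r \<and> r < e n \<and> 0 < s' \<and> s' < e n \<and> 0 < r' \<and> r' < e n \<and>
      ?D v w (x + s *\<^sub>R v + r *\<^sub>R w) = ?D w v (x + s' *\<^sub>R w + r' *\<^sub>R v)"
      using 1 2 e_pos[of n] by (intro exI[of _ s] exI[of _ r] exI[of _ s'] exI[of _ r']) simp
  qed
  then obtain s r s' r' where
    b: "\<And>n. 0 < s n" "\<And>n. s n < e n" "\<And>n. 0 < r n" "\<And>n. r n < e n"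
      "\<And>n. 0 < s' n" "\<And>n. s' n < e n" "\<And>n. 0 < r' n" "\<And>n. r' n < e n"
    and eq: "\<And>n. ?D v w (x + s n *\<^sub>R v + r n *\<^sub>R w) = ?D w v (x + s' n *\<^sub>R w + r' n *\<^sub>R v)"
    by metis
  have e0: "e \<longlonglongrightarrow> 0"
  proof -
    have "(\<lambda>n. (d / (norm v + norm w + 1) / 2) * inverse (real (Suc n))) \<longlonglongrightarrow> 0"
      by (intro tendsto_mult_right_zero LIMSEQ_inverse_real_of_nat)
    then show ?thesis by (rule tendsto_eq_rhs[THEN Lim_transform_eventually]) (auto simp: e_def field_simps)
  qed
  have z: "q \<longlonglongrightarrow> 0" if "\<And>n. 0 < q n" "\<And>n. q n < e n" for q
    by (rule tendsto_sandwich[OF _ _ tendsto_const e0])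
      (simp_all add: that less_imp_le)
  have cont: "isCont (?D a b) x" for a b
    using smooth_on_continuous_on[OF smooth_on_frechet[OF smooth_on_frechet[OF assms(2)]]]
      assms(1,3) by (simp add: continuous_on_eq_continuous_at)
  have "(\<lambda>n. x + s n *\<^sub>R v + r n *\<^sub>R w) \<longlonglongrightarrow> x + 0 *\<^sub>R v + 0 *\<^sub>R w"
    by (intro tendsto_intros z b)
  then have 1: "(\<lambda>n. ?D v w (x + s n *\<^sub>R v + r n *\<^sub>R w)) \<longlonglongrightarrow> ?D v w x"
    by (intro isCont_tendsto_compose[OF cont]) simp
  have "(\<lambda>n. x + s' n *\<^sub>R w + r' n *\<^sub>R v) \<longlonglongrightarrow> x + 0 *\<^sub>R w + 0 *\<^sub>R v"
    by (intro tendsto_intros z b)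
  then have 2: "(\<lambda>n. ?D w v (x + s' n *\<^sub>R w + r' n *\<^sub>R v)) \<longlonglongrightarrow> ?D w v x"
    by (intro isCont_tendsto_compose[OF cont]) simp
  show ?thesis using LIMSEQ_unique[OF 1] 2 eq by simp
qed

lemma second_derivative_symmetric:
  fixes f :: "'b::euclidean_space \<Rightarrow> 'c::euclidean_space"
  assumes "open S" "smooth_on S f" "x \<in> S"
  shows "frechet_derivative (\<lambda>y. frechet_derivative f (at y) v) (at x) w =
    frechet_derivative (\<lambda>y. frechet_derivative f (at y) w) (at x) v"
proof (rule euclidean_eqI)
  fix b :: 'c assume "b \<in> Basis"
  have comp: "frechet_derivative (\<lambda>y. h y \<bullet> b) (at y) v = frechet_derivative h (at y) v \<bullet> b"
    if "smooth_on S h" "y \<in> S" for h :: "'b \<Rightarrow> 'c" and y v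
    using has_derivative_inner_left[OF smooth_on_has_derivative[OF that], of b]
    by (simp add: frechet_derivative_eqI)
  have two: "frechet_derivative (\<lambda>y. frechet_derivative (\<lambda>y. f y \<bullet> b) (at y) v) (at x) w =
      frechet_derivative (\<lambda>y. frechet_derivative f (at y) v) (at x) w \<bullet> b" for v w
  proof -
    have d: "(\<lambda>y. frechet_derivative f (at y) v \<bullet> b) differentiable at x"
      using has_derivative_inner_left[OF smooth_on_has_derivative[OF smooth_on_frechet[OF assms(2)] assms(3)]]
      by (auto simp: differentiable_def)
    have "frechet_derivative (\<lambda>y. frechet_derivative f (at y) v \<bullet> b) (at x) =
        frechet_derivative (\<lambda>y. frechet_derivative (\<lambda>y. f y \<bullet> b) (at y) v) (at x)"
      by (rule frechet_derivative_transform_within_open[OF d assms(1,3)]) (simp add: comp[OF assms(2)])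
    then show ?thesis using comp[OF smooth_on_frechet[OF assms(2)] assms(3), of v w] by simp
  qed
  have "smooth_on S (\<lambda>y. f y \<bullet> b)"
    by (rule smooth_on_bounded_linear[OF assms(1) bounded_linear_inner_left assms(2)])
  from second_derivative_symmetric_real[OF assms(1) this assms(3)] two
  show "frechet_derivative (\<lambda>y. frechet_derivative f (at y) v) (at x) w \<bullet> b =
    frechet_derivative (\<lambda>y. frechet_derivative f (at y) w) (at x) v \<bullet> b" by metis
qed

section \<open>Metric and connection in a chart\<close>

text \<open>The connection coefficients as one bilinear map, so that identities can be argued by
  bilinearity, symmetry and nondegeneracy of the metric instead of index sums.\<close>

definition chris :: "'a metric_family \<Rightarrow> 'a chart \<Rightarrow> real^2 \<Rightarrow> real^2 \<Rightarrow> real^2 \<Rightarrow> real^2" where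
  "chris g c x v w = (\<chi> k. \<Sum>i\<in>UNIV. \<Sum>j\<in>UNIV. christoffel g c k i j x * v $ i * w $ j)"

lemma cov_deriv_chris:
  "cov_deriv g \<gamma> V c t =
    vector_derivative (V c) (at t) + chris g c (coord c (\<gamma> t)) (velocity \<gamma> c t) (V c t)"
  by (simp add: cov_deriv_def chris_def)

lemma bounded_bilinear_chris: "bounded_bilinear (chris g c x)"
proof -
  have "bilinear (chris g c x)"
    unfolding bilinear_def
    by (auto intro!: linearI simp: chris_def vec_eq_iff sum_2 algebra_simps)
  then show ?thesis by (rule bilinear_conv_bounded_bilinear[THEN iffD1])
qed

lemma metric_inner_expand:
  "metric_inner g c x v w = (\<Sum>i\<in>UNIV. \<Sum>j\<in>UNIV. v $ i * g c x $ i $ j * w $ j)"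
  by (simp add: metric_inner_def inner_vec_def matrix_vector_mult_def sum_2 algebra_simps)

lemma bounded_bilinear_metric_inner: "bounded_bilinear (metric_inner g c x)"
proof -
  have "bilinear (metric_inner g c x)"
    unfolding bilinear_def
    by (auto intro!: linearI simp: metric_inner_expand sum_2 algebra_simps)
  then show ?thesis by (rule bilinear_conv_bounded_bilinear[THEN iffD1])
qed

lemmas chris_simps =
  bounded_bilinear.add_left[OF bounded_bilinear_chris] bounded_bilinear.add_right[OF bounded_bilinear_chris]
  bounded_bilinear.scaleR_left[OF bounded_bilinear_chris] bounded_bilinear.scaleR_right[OF bounded_bilinear_chris]

lemmas metric_inner_simps =
  bounded_bilinear.add_left[OF bounded_bilinear_metric_inner]
  bounded_bilinear.add_right[OF bounded_bilinear_metric_inner]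
  bounded_bilinear.diff_left[OF bounded_bilinear_metric_inner]
  bounded_bilinear.diff_right[OF bounded_bilinear_metric_inner]
  bounded_bilinear.minus_left[OF bounded_bilinear_metric_inner]
  bounded_bilinear.minus_right[OF bounded_bilinear_metric_inner]
  bounded_bilinear.scaleR_left[OF bounded_bilinear_metric_inner]
  bounded_bilinear.scaleR_right[OF bounded_bilinear_metric_inner]
  bounded_bilinear.zero_left[OF bounded_bilinear_metric_inner]
  bounded_bilinear.zero_right[OF bounded_bilinear_metric_inner]

lemma matrix_inv_works:
  fixes M :: "real^'n^'n"
  assumes "invertible M"
  shows "M ** matrix_inv M = mat 1" "matrix_inv M ** M = mat 1"
  using someI_ex[of "\<lambda>B. M ** B = mat 1 \<and> B ** M = mat 1"] assms
  by (auto simp: matrix_inv_def invertible_def)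

text \<open>Cramer's rule; it exhibits the entries of the inverse metric as smooth functions of
  those of the metric.\<close>

lemma matrix_inv_2:
  fixes M :: "real^2^2"
  assumes "det M \<noteq> 0"
  shows "matrix_inv M $ 1 $ 1 = M $ 2 $ 2 * inverse (det M)"
    "matrix_inv M $ 1 $ 2 = - M $ 1 $ 2 * inverse (det M)"
    "matrix_inv M $ 2 $ 1 = - M $ 2 $ 1 * inverse (det M)"
    "matrix_inv M $ 2 $ 2 = M $ 1 $ 1 * inverse (det M)"
proof -
  define B :: "real^2^2" where
    "B = vector [vector [M $ 2 $ 2 * inverse (det M), - M $ 1 $ 2 * inverse (det M)],
      vector [- M $ 2 $ 1 * inverse (det M), M $ 1 $ 1 * inverse (det M)]]"
  have i: "(M $ 1 $ 1 * M $ 2 $ 2 - M $ 1 $ 2 * M $ 2 $ 1) * inverse (det M) = 1"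
    using assms by (simp add: det_2)
  have "M ** B = mat 1"
    using i by (simp add: vec_eq_iff forall_2 matrix_matrix_mult_def sum_2 mat_def B_def algebra_simps)
  then have "matrix_inv M = B"
    by (metis assms invertible_det_nz matrix_inv_works(2) matrix_mul_assoc matrix_mul_lid matrix_mul_rid)
  then show "matrix_inv M $ 1 $ 1 = M $ 2 $ 2 * inverse (det M)"
    "matrix_inv M $ 1 $ 2 = - M $ 1 $ 2 * inverse (det M)"
    "matrix_inv M $ 2 $ 1 = - M $ 2 $ 1 * inverse (det M)"
    "matrix_inv M $ 2 $ 2 = M $ 1 $ 1 * inverse (det M)"
    by (simp_all add: B_def)
qed

text \<open>The derivative of the metric with \<open>v\<close> and \<open>w\<close> frozen, from
  which the Koszul formula builds the connection.\<close>

definition dmetric :: "'a metric_family \<Rightarrow> 'a chart \<Rightarrow> real^2 \<Rightarrow> real^2 \<Rightarrow> real^2 \<Rightarrow> real^2 \<Rightarrow> real" where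
  "dmetric g c x a v w = v \<bullet> (frechet_derivative (g c) (at x) a *v w)"

context riemannian_surface
begin

abbreviation img :: "'a chart \<Rightarrow> (real^2) set" where
  "img c \<equiv> coord c ` dom_of c"

section \<open>The Levi-Civita connection: symmetry, metric compatibility, smoothness\<close>

lemma metric_component_sym:
  assumes "c \<in> A" "x \<in> img c"
  shows "g c x $ i $ j = g c x $ j $ i"
  using arg_cong[OF metric_symmetric[OF assms], of "\<lambda>M. M $ j $ i"] by (simp add: transpose_def)

lemma metric_inner_sym:
  assumes "c \<in> A" "x \<in> img c"
  shows "metric_inner g c x v w = metric_inner g c x w v"
  using metric_component_sym[OF assms, of 1 2] by (simp add: metric_inner_expand sum_2)

lemma metric_inner_cancel:
  assumes "c \<in> A" "x \<in> img c" "\<And>z. metric_inner g c x v z = metric_inner g c x w z"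
  shows "v = w"
proof (rule ccontr)
  assume "v \<noteq> w"
  then have "metric_inner g c x (v - w) (v - w) > 0" using metric_positive assms by simp
  then show False using assms(3) by (simp add: metric_inner_simps)
qed

lemma det_metric_nz:
  assumes "c \<in> A" "x \<in> img c"
  shows "det (g c x) \<noteq> 0"
proof -
  have "v = 0" if "g c x *v v = 0" for v
    using metric_positive[OF assms, of v] that by (auto simp: metric_inner_def)
  then show ?thesis
    by (simp add: invertible_det_nz[symmetric] invertible_left_inverse matrix_left_invertible_ker)
qed

lemma metric_component_smooth: "c \<in> A \<Longrightarrow> smooth_on (img c) (\<lambda>x. g c x $ i $ j)"
  by (intro smooth_on_nth chart_image metric_smooth)

lemma metric_has_derivative:
  "c \<in> A \<Longrightarrow> x \<in> img c \<Longrightarrow> (g c has_derivative frechet_derivative (g c) (at x)) (at x)"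
  using smooth_on_has_derivative[OF metric_smooth] .

lemma frechet_metric_component:
  assumes "c \<in> A" "x \<in> img c"
  shows "frechet_derivative (\<lambda>x. g c x $ i $ j) (at x) v = frechet_derivative (g c) (at x) v $ i $ j"
  using metric_has_derivative[OF assms, THEN bounded_linear.has_derivative[OF bounded_linear_vec_nth],
      THEN bounded_linear.has_derivative[OF bounded_linear_vec_nth], THEN frechet_derivative_eqI]
  by simp

text \<open>The metric is known to be symmetric only on the image of the chart; openness of the
  image lets the equal components be differentiated.\<close>

lemma dmetric_sym:
  assumes "c \<in> A" "x \<in> img c"
  shows "dmetric g c x a v w = dmetric g c x a w v"
proof -
  have d: "(\<lambda>y. g c y $ 1 $ 2) differentiable at x"
    using smooth_on_differentiable[OF metric_component_smooth] assms by blast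
  have "frechet_derivative (\<lambda>y. g c y $ 1 $ 2) (at x) = frechet_derivative (\<lambda>y. g c y $ 2 $ 1) (at x)"
  proof (rule frechet_derivative_transform_within_open[OF d chart_image[OF assms(1)] assms(2)])
  qed (rule metric_component_sym[OF assms(1)])
  then have "frechet_derivative (g c) (at x) a $ 1 $ 2 = frechet_derivative (g c) (at x) a $ 2 $ 1"
    using frechet_metric_component[OF assms, of 1 2 a] frechet_metric_component[OF assms, of 2 1 a] by simp
  then show ?thesis
    by (simp add: dmetric_def inner_vec_def matrix_vector_mult_def sum_2 algebra_simps)
qed

lemma frechet_metric_expand:
  assumes "c \<in> A" "x \<in> img c"
  shows "frechet_derivative (g c) (at x) a = a $ 1 *\<^sub>R frechet_derivative (g c) (at x) (axis 1 1)
      + a $ 2 *\<^sub>R frechet_derivative (g c) (at x) (axis 2 1)"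
proof -
  have L: "linear (frechet_derivative (g c) (at x))"
    using metric_has_derivative[OF assms] by (rule has_derivative_linear)
  have "a = a $ 1 *\<^sub>R axis 1 1 + a $ 2 *\<^sub>R axis 2 1"
    by (simp add: vec_eq_iff forall_2 axis_def)
  then have "frechet_derivative (g c) (at x) a =
      frechet_derivative (g c) (at x) (a $ 1 *\<^sub>R axis 1 1 + a $ 2 *\<^sub>R axis 2 1)" by simp
  then show ?thesis by (simp only: linear_add[OF L] linear_scale[OF L])
qed

text \<open>The Koszul formula for constant coordinate fields. Pairing with the metric cancels its
  inverse in the Christoffel symbols; the rest is linear in each direction and is compared after
  expansion in coordinate directions.\<close>

lemma koszul:
  assumes "c \<in> A" "x \<in> img c"
  shows "2 * metric_inner g c x (chris g c x v w) z =
    dmetric g c x v w z + dmetric g c x w v z - dmetric g c x z v w"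
proof -
  define D where "D i = frechet_derivative (g c) (at x) (axis i 1)" for i
  \<comment> \<open>Twice the connection term with its index lowered: the covector to which the
    inverse metric is applied.\<close>
  define a where "a = (\<chi> l. \<Sum>i\<in>UNIV. \<Sum>j\<in>UNIV. (D i $ j $ l + D j $ i $ l - D l $ i $ j) * v $ i * w $ j)"
  have "invertible (g c x)" using det_metric_nz[OF assms] by (simp add: invertible_det_nz)
  note inv = matrix_inv_works[OF this]
  have Cf: "christoffel g c k i j x = (\<Sum>l\<in>UNIV. matrix_inv (g c x) $ k $ l *
      (D i $ j $ l + D j $ i $ l - D l $ i $ j)) / 2" for k i j
    by (simp add: christoffel_def partial_def frechet_metric_component[OF assms] D_def)
  have "chris g c x v w = (1/2) *\<^sub>R (matrix_inv (g c x) *v a)"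
    by (simp add: chris_def a_def vec_eq_iff matrix_vector_mult_def sum_2 Cf)
      (simp add: algebra_simps add_divide_distrib diff_divide_distrib)
  then have "2 * metric_inner g c x (chris g c x v w) z = metric_inner g c x (matrix_inv (g c x) *v a) z"
    by (simp add: metric_inner_simps)
  also have "\<dots> = metric_inner g c x z (matrix_inv (g c x) *v a)"
    by (rule metric_inner_sym[OF assms])
  also have "\<dots> = z \<bullet> a"
    by (simp add: metric_inner_def matrix_vector_mul_assoc inv)
  also have "\<dots> = dmetric g c x v w z + dmetric g c x w v z - dmetric g c x z v w"
    unfolding dmetric_def frechet_metric_expand[OF assms, of v] frechet_metric_expand[OF assms, of w]
      frechet_metric_expand[OF assms, of z] D_def[symmetric]
    by (simp add: a_def inner_vec_def matrix_vector_mult_def sum_2 algebra_simps)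
  finally show ?thesis .
qed

text \<open>Absence of torsion: the Koszul expression is symmetric in \<open>v\<close> and
  \<open>w\<close>, and the metric is nondegenerate.\<close>

lemma chris_sym:
  assumes "c \<in> A" "x \<in> img c"
  shows "chris g c x v w = chris g c x w v"
proof (rule metric_inner_cancel[OF assms])
  show "metric_inner g c x (chris g c x v w) z = metric_inner g c x (chris g c x w v) z" for z
    using koszul[OF assms, of v w z] koszul[OF assms, of w v z] dmetric_sym[OF assms, of z v w] by simp
qed

text \<open>In the sum of the Koszul formulas for \<open>a\<close>, \<open>v\<close> tested on
  \<open>w\<close> and for \<open>a\<close>, \<open>w\<close> tested on \<open>v\<close>, everything
  cancels except twice the derivative along \<open>a\<close>.\<close>

lemma metric_compatible:
  assumes "c \<in> A" "x \<in> img c"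
  shows "metric_inner g c x (chris g c x a v) w + metric_inner g c x v (chris g c x a w) = dmetric g c x a v w"
  using koszul[OF assms, of a v w] koszul[OF assms, of a w v] dmetric_sym[OF assms, of a v w]
    dmetric_sym[OF assms, of v a w] dmetric_sym[OF assms, of w a v]
    metric_inner_sym[OF assms, of v] by simp

lemma christoffel_smooth:
  assumes "c \<in> A"
  shows "smooth_on (img c) (christoffel g c k i j)"
proof -
  note o = chart_image[OF assms]
  have det: "smooth_on (img c) (\<lambda>x. inverse (det (g c x)))"
    using det_metric_nz[OF assms] unfolding det_2
    by (intro smooth_on_inverse o smooth_on_diff smooth_on_mult metric_component_smooth assms) auto
  have inv: "smooth_on (img c) (\<lambda>x. matrix_inv (g c x) $ k $ l)" for k l
  proof -
    have "smooth_on (img c) (\<lambda>x. if k = 1 then if l = 1 then g c x $ 2 $ 2 * inverse (det (g c x))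
          else - g c x $ 1 $ 2 * inverse (det (g c x))
        else if l = 1 then - g c x $ 2 $ 1 * inverse (det (g c x)) else g c x $ 1 $ 1 * inverse (det (g c x)))"
      using exhaust_2[of k] exhaust_2[of l]
      by (auto intro!: smooth_on_mult o det metric_component_smooth assms smooth_on_minus)
    then show ?thesis
      by (rule smooth_on_cong[OF o, rotated])
        (use exhaust_2[of k] exhaust_2[of l] matrix_inv_2 det_metric_nz[OF assms] in auto)
  qed
  have part: "smooth_on (img c) (partial i (\<lambda>y. g c y $ j $ l))" for i j l
    unfolding partial_def by (rule smooth_on_frechet[OF metric_component_smooth[OF assms]])
  show ?thesis
    unfolding christoffel_def divide_inverse
    by (intro smooth_on_mult smooth_on_sum smooth_on_const o inv smooth_on_add smooth_on_diff part)
qed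

lemma smooth_on_chris:
  assumes "c \<in> A" "open S" "X ` S \<subseteq> img c" "smooth_on S X" "smooth_on S V" "smooth_on S W"
  shows "smooth_on S (\<lambda>p. chris g c (X p) (V p) (W p))"
proof (rule smooth_on_vec[OF assms(2)])
  show "smooth_on S (\<lambda>p. chris g c (X p) (V p) (W p) $ k)" for k
    unfolding chris_def vec_lambda_beta
    by (intro smooth_on_sum smooth_on_mult smooth_on_nth assms
        smooth_on_compose[OF assms(2,3) christoffel_smooth[OF assms(1)]])
qed

lemma smooth_on_metric_inner:
  assumes "c \<in> A" "open S" "X ` S \<subseteq> img c" "smooth_on S X" "smooth_on S V" "smooth_on S W"
  shows "smooth_on S (\<lambda>p. metric_inner g c (X p) (V p) (W p))"
  unfolding metric_inner_expand
  by (intro smooth_on_sum smooth_on_mult smooth_on_nth assms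
        smooth_on_compose[OF assms(2,3) metric_component_smooth[OF assms(1)]])

text \<open>The product rule combined with \<open>metric_compatible\<close>. The form with a bare
  coordinate curve \<open>X\<close> serves both straight lines in a chart and the transversal curves
  of a variation.\<close>

lemma metric_inner_has_derivative:
  assumes "c \<in> A" "X t \<in> img c"
    and "(X has_vector_derivative X') (at t)" "(V has_vector_derivative V') (at t)"
      "(W has_vector_derivative W') (at t)"
  shows "((\<lambda>t. metric_inner g c (X t) (V t) (W t)) has_real_derivative
    metric_inner g c (X t) (V' + chris g c (X t) X' (V t)) (W t) +
    metric_inner g c (X t) (V t) (W' + chris g c (X t) X' (W t))) (at t)"
proof -
  have L: "linear (frechet_derivative (g c) (at (X t)))"
    using metric_has_derivative[OF assms(1,2)] by (rule has_derivative_linear)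
  have "((\<lambda>t. g c (X t)) has_derivative (\<lambda>h. frechet_derivative (g c) (at (X t)) (h *\<^sub>R X'))) (at t)"
    using has_derivative_compose[OF assms(3)[unfolded has_vector_derivative_def] metric_has_derivative[OF assms(1,2)]] .
  then have G: "((\<lambda>t. g c (X t)) has_vector_derivative frechet_derivative (g c) (at (X t)) X') (at t)"
    by (simp add: has_vector_derivative_def linear_scale[OF L])
  have nth: "((\<lambda>t. F t $ i) has_real_derivative F' $ i) (at t)"
    if "(F has_vector_derivative F') (at t)" for F :: "real \<Rightarrow> real^2" and F' i
    using bounded_linear.has_vector_derivative[OF bounded_linear_vec_nth that]
    by (simp add: has_real_derivative_iff_has_vector_derivative)
  have G2: "((\<lambda>t. g c (X t) $ i $ j) has_real_derivative frechet_derivative (g c) (at (X t)) X' $ i $ j) (at t)" for i j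
    by (rule nth, rule bounded_linear.has_vector_derivative[OF bounded_linear_vec_nth G])
  have "((\<lambda>t. metric_inner g c (X t) (V t) (W t)) has_real_derivative
      metric_inner g c (X t) V' (W t) + dmetric g c (X t) X' (V t) (W t) + metric_inner g c (X t) (V t) W') (at t)"
    unfolding metric_inner_expand dmetric_def sum_2
    by (rule derivative_eq_intros nth[OF assms(4)] nth[OF assms(5)] G2 refl)+
      (simp add: inner_vec_def matrix_vector_mult_def sum_2 algebra_simps)
  then show ?thesis
    by (simp add: metric_inner_simps metric_compatible[OF assms(1,2), symmetric] algebra_simps)
qed

end

lemma smooth_on_chain:
  fixes f :: "'b::euclidean_space \<Rightarrow> 'c::real_normed_vector"
  assumes "smooth_on S f" "y t \<in> S" "(y has_vector_derivative y') (at t)"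
  shows "((\<lambda>s. f (y s)) has_vector_derivative frechet_derivative f (at (y t)) y') (at t)"
  using has_derivative_compose[OF assms(3)[unfolded has_vector_derivative_def]
      smooth_on_has_derivative[OF assms(1,2)]]
  by (simp add: has_vector_derivative_def linear_scale[OF linear_frechet[OF smooth_on_differentiable[OF assms(1,2)]]])

text \<open>The base point \<open>y s\<close> moves, so the linear map applied to \<open>V s\<close>
  changes with \<open>s\<close>, and only its values on fixed vectors have known derivatives. The
  basis expansion reduces to these; it is valid near \<open>t\<close>, where \<open>y s\<close>
  stays in \<open>S\<close>.\<close>

lemma frechet_apply_has_vector_derivative:
  fixes f :: "'b::euclidean_space \<Rightarrow> 'c::real_normed_vector"
  assumes "open S" "smooth_on S f" "y t \<in> S"
    and y: "(y has_vector_derivative y') (at t)" and V: "(V has_vector_derivative V') (at t)"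
  shows "((\<lambda>s. frechet_derivative f (at (y s)) (V s)) has_vector_derivative
    (frechet_derivative f (at (y t)) V' +
      frechet_derivative (\<lambda>p. frechet_derivative f (at p) (V t)) (at (y t)) y')) (at t)"
proof -
  let ?D = "\<lambda>p. frechet_derivative f (at p)"
  have expand: "?D p v = (\<Sum>b\<in>Basis. (v \<bullet> b) *\<^sub>R ?D p b)" if "p \<in> S" for p v
  proof -
    have L: "linear (?D p)" using linear_frechet smooth_on_differentiable[OF assms(2) that] by blast
    show ?thesis
      by (subst euclidean_representation[of v, symmetric]) (simp only: linear_sum[OF L] linear_scale[OF L])
  qed
  have chain: "((\<lambda>s. ?D (y s) b) has_vector_derivative frechet_derivative (\<lambda>p. ?D p b) (at (y t)) y') (at t)" for b
    by (rule smooth_on_chain[OF smooth_on_frechet[OF assms(2)] assms(3) y])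
  have inner: "((\<lambda>s. V s \<bullet> b) has_real_derivative V' \<bullet> b) (at t)" for b
    using bounded_linear.has_vector_derivative[OF bounded_linear_inner_left V]
    by (simp add: has_real_derivative_iff_has_vector_derivative)
  have "((\<lambda>s. \<Sum>b\<in>Basis. (V s \<bullet> b) *\<^sub>R ?D (y s) b) has_vector_derivative
      (\<Sum>b\<in>Basis. (V t \<bullet> b) *\<^sub>R frechet_derivative (\<lambda>p. ?D p b) (at (y t)) y' + (V' \<bullet> b) *\<^sub>R ?D (y t) b)) (at t)"
    by (intro has_vector_derivative_sum has_vector_derivative_scaleR inner chain)
  moreover have "(\<Sum>b\<in>Basis. (V t \<bullet> b) *\<^sub>R frechet_derivative (\<lambda>p. ?D p b) (at (y t)) y') =
      frechet_derivative (\<lambda>p. ?D p (V t)) (at (y t)) y'"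
  proof -
    have "((\<lambda>p. \<Sum>b\<in>Basis. (V t \<bullet> b) *\<^sub>R ?D p b) has_derivative
        (\<lambda>h. \<Sum>b\<in>Basis. (V t \<bullet> b) *\<^sub>R frechet_derivative (\<lambda>p. ?D p b) (at (y t)) h)) (at (y t))"
      by (intro has_derivative_sum has_derivative_scaleR_right
          smooth_on_has_derivative[OF smooth_on_frechet[OF assms(2)] assms(3)])
    then have "((\<lambda>p. ?D p (V t)) has_derivative
        (\<lambda>h. \<Sum>b\<in>Basis. (V t \<bullet> b) *\<^sub>R frechet_derivative (\<lambda>p. ?D p b) (at (y t)) h)) (at (y t))"
      by (rule has_derivative_transform_within_open[OF _ assms(1,3)]) (simp add: expand[symmetric])
    then show ?thesis by (simp add: frechet_derivative_eqI)
  qed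
  ultimately have *: "((\<lambda>s. \<Sum>b\<in>Basis. (V s \<bullet> b) *\<^sub>R ?D (y s) b) has_vector_derivative
      ?D (y t) V' + frechet_derivative (\<lambda>p. ?D p (V t)) (at (y t)) y') (at t)"
    by (simp add: sum.distrib expand[OF assms(3), of V'] add.commute)
  have "isCont y t" using y by (rule has_vector_derivative_continuous)
  then have "\<forall>\<^sub>F s in at t. y s \<in> S"
    using assms(1,3) unfolding continuous_at by (rule topological_tendstoD)
  then have "\<forall>\<^sub>F s in at t. (\<Sum>b\<in>Basis. (V s \<bullet> b) *\<^sub>R ?D (y s) b) = ?D (y s) (V s)"
    by eventually_elim (rule expand[symmetric])
  then show ?thesis
    using * expand[OF assms(3), symmetric] unfolding has_vector_derivative_def
    by (intro has_derivative_transform_eventually[OF *[unfolded has_vector_derivative_def]]) auto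
qed

context riemannian_surface
begin

section \<open>Change of charts\<close>

lemma topspace_chart: "c \<in> A \<Longrightarrow> topspace (subtopology N (dom_of c)) = dom_of c"
  using openin_subset[OF chart_dom[of c]] by auto

lemma coord_inj: "c \<in> A \<Longrightarrow> inj_on (coord c) (dom_of c)"
  using homeomorphic_imp_injective_map[OF chart_homeo[of c]] by (simp only: topspace_chart)

lemma transition_coord: "c \<in> A \<Longrightarrow> p \<in> dom_of c \<Longrightarrow> transition c c' (coord c p) = coord c' p"
  by (simp add: transition_def coord_inj)

lemma open_coord_image:
  assumes "c \<in> A" "openin N W"
  shows "open (coord c ` (dom_of c \<inter> W))"
proof -
  have "openin (subtopology N (dom_of c)) (dom_of c \<inter> W)"
    using assms(2) by (auto simp: openin_subtopology)
  then have "openin (top_of_set (img c)) (coord c ` (dom_of c \<inter> W))"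
    using homeomorphic_imp_open_map[OF chart_homeo[OF assms(1)]] by (simp add: open_map_def)
  then show ?thesis using chart_image[OF assms(1)] openin_open_eq by blast
qed

lemma overlap_open: "c \<in> A \<Longrightarrow> c' \<in> A \<Longrightarrow> open (coord c ` (dom_of c \<inter> dom_of c'))"
  by (rule open_coord_image[OF _ chart_dom])

lemma transition_img:
  assumes "c \<in> A" "c' \<in> A" "x \<in> coord c ` (dom_of c \<inter> dom_of c')"
  shows "x \<in> img c" "transition c c' x \<in> img c'"
  using assms by (auto simp: transition_coord)

text \<open>A change of charts preserves the positive definite metric, so its derivative has trivial
  kernel; in finite dimension this gives surjectivity without differentiating the inverse
  transition.\<close>

lemma transition_deriv_surj:
  assumes "c \<in> A" "c' \<in> A" "x \<in> coord c ` (dom_of c \<inter> dom_of c')"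
  shows "surj (frechet_derivative (transition c c') (at x))"
proof -
  let ?J = "frechet_derivative (transition c c') (at x)"
  have L: "linear ?J"
    using linear_frechet[OF smooth_on_differentiable[OF transition_smooth]] assms by blast
  have "v = 0" if "?J v = 0" for v
  proof (rule ccontr)
    assume "v \<noteq> 0"
    then have "metric_inner g c x v v > 0" using metric_positive transition_img assms by blast
    then show False using metric_transform[OF assms, of v v] that by (simp add: metric_inner_simps)
  qed
  then have "inj ?J" using L by (simp add: linear_injective_0)
  then show ?thesis by (rule linear_injective_imp_surjective[OF L]) simp
qed

text \<open>The defect \<open>E\<close> of the transformation law is symmetric, while compatibility with the metric
  makes \<open>\<langle>E a w, J z\<rangle>\<close> antisymmetric in \<open>w\<close>, \<open>z\<close>; such a trilinear form vanishes.\<close>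

lemma chris_transform:
  fixes c c' x
  defines "\<psi> \<equiv> transition c c'"
  assumes c: "c \<in> A" "c' \<in> A" "x \<in> coord c ` (dom_of c \<inter> dom_of c')"
  shows "frechet_derivative \<psi> (at x) (chris g c x v w) =
    frechet_derivative (\<lambda>y. frechet_derivative \<psi> (at y) w) (at x) v +
    chris g c' (\<psi> x) (frechet_derivative \<psi> (at x) v) (frechet_derivative \<psi> (at x) w)"
proof -
  let ?S = "coord c ` (dom_of c \<inter> dom_of c')"
  let ?J = "frechet_derivative \<psi> (at x)"
  let ?m = "metric_inner g c' (\<psi> x)"
  let ?H = "\<lambda>a w. frechet_derivative (\<lambda>y. frechet_derivative \<psi> (at y) w) (at x) a"
  have oS: "open ?S" by (rule overlap_open[OF c(1,2)])
  have sm: "smooth_on ?S \<psi>" unfolding \<psi>_def by (rule transition_smooth[OF c(1,2)])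
  have L: "linear ?J" using linear_frechet smooth_on_differentiable[OF sm c(3)] by blast
  have x: "x \<in> img c" "\<psi> x \<in> img c'" using transition_img[OF c] by (simp_all add: \<psi>_def)
  define E where "E a w = ?J (chris g c x a w) - ?H a w - chris g c' (\<psi> x) (?J a) (?J w)" for a w
  have E_sym: "E a w = E w a" for a w
    using second_derivative_symmetric[OF oS sm c(3), of w a] chris_sym[OF c(1) x(1), of a w]
      chris_sym[OF c(2) x(2), of "?J a" "?J w"]
    by (simp add: E_def)
  \<comment> \<open>The isometry relation is differentiated along the line through \<open>x\<close>
    in direction \<open>a\<close>, once in each chart; \<open>w\<close> and \<open>z\<close> are
    constant in \<open>c\<close>, but their images move in \<open>c'\<close>.\<close>
  have E_anti: "?m (E a w) (?J z) = - ?m (?J w) (E a z)" for a w z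
  proof -
    have line: "((\<lambda>s. x + s *\<^sub>R a) has_vector_derivative a) (at 0)"
      by (auto intro!: derivative_eq_intros simp: has_vector_derivative_def)
    have const: "((\<lambda>s. w) has_vector_derivative 0) (at (0::real))" for w :: "real^2"
      by (rule has_vector_derivative_const)
    have "((\<lambda>s. metric_inner g c (x + s *\<^sub>R a) w z) has_real_derivative
        metric_inner g c x (chris g c x a w) z + metric_inner g c x w (chris g c x a z)) (at 0)"
      using metric_inner_has_derivative[OF c(1) _ line const const, of w z] x by simp
    moreover have "((\<lambda>s. metric_inner g c (x + s *\<^sub>R a) w z) has_real_derivative
        ?m (?H a w + chris g c' (\<psi> x) (?J a) (?J w)) (?J z) +
        ?m (?J w) (?H a z + chris g c' (\<psi> x) (?J a) (?J z))) (at 0)"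
    proof -
      have "\<forall>\<^sub>F s in nhds 0. x + s *\<^sub>R a \<in> ?S"
      proof -
        have "((\<lambda>s. x + s *\<^sub>R a) \<longlongrightarrow> x + 0 *\<^sub>R a) (nhds 0)"
          by (intro tendsto_intros filterlim_ident)
        from topological_tendstoD[OF this oS] show ?thesis using c(3) by simp
      qed
      then have ev: "\<forall>\<^sub>F s in nhds 0. metric_inner g c' (\<psi> (x + s *\<^sub>R a))
            (frechet_derivative \<psi> (at (x + s *\<^sub>R a)) w) (frechet_derivative \<psi> (at (x + s *\<^sub>R a)) z) =
          metric_inner g c (x + s *\<^sub>R a) w z"
        by eventually_elim (use metric_transform[OF c(1,2)] in \<open>simp add: \<psi>_def\<close>)
      have D: "((\<lambda>s. frechet_derivative \<psi> (at (x + s *\<^sub>R a)) w) has_vector_derivative ?H a w) (at 0)" for w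
        using smooth_on_chain[OF smooth_on_frechet[OF sm] _ line, of w] c(3) by simp
      have P: "((\<lambda>s. \<psi> (x + s *\<^sub>R a)) has_vector_derivative ?J a) (at 0)"
        using smooth_on_chain[OF sm _ line] c(3) by simp
      have "((\<lambda>s. metric_inner g c' (\<psi> (x + s *\<^sub>R a))
            (frechet_derivative \<psi> (at (x + s *\<^sub>R a)) w) (frechet_derivative \<psi> (at (x + s *\<^sub>R a)) z))
          has_real_derivative
            ?m (?H a w + chris g c' (\<psi> x) (?J a) (?J w)) (?J z) +
            ?m (?J w) (?H a z + chris g c' (\<psi> x) (?J a) (?J z))) (at 0)"
        using metric_inner_has_derivative[OF c(2) _ P D D, of w z] x by simp
      then show ?thesis using DERIV_cong_ev[OF refl ev refl] by blast
    qed
    ultimately have "metric_inner g c x (chris g c x a w) z + metric_inner g c x w (chris g c x a z) =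
        ?m (?H a w + chris g c' (\<psi> x) (?J a) (?J w)) (?J z) +
        ?m (?J w) (?H a z + chris g c' (\<psi> x) (?J a) (?J z))"
      by (rule DERIV_unique)
    then show ?thesis
      using metric_transform[OF c] by (simp add: E_def \<psi>_def[symmetric] metric_inner_simps)
  qed
  define F where "F a w z = ?m (E a w) (?J z)" for a w z
  have F1: "F a w z = F w a z" for a w z using E_sym by (simp add: F_def)
  have F2: "F a w z = - F a z w" for a w z
    using E_anti[of a w z] metric_inner_sym[OF c(2) x(2)] by (simp add: F_def)
  \<comment> \<open>Six swaps, alternately of the last two and of the first two arguments, lead back
    to \<open>F v w z\<close>; three of them change the sign.\<close>
  have "F v w z = 0" for z
    using F2[of v w z] F1[of v z w] F2[of z v w] F1[of z w v] F2[of w z v] F1[of w v z] by linarith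
  then have "?m (E v w) z = ?m 0 z" for z
    using surjD[OF transition_deriv_surj[OF c, folded \<psi>_def], of z] by (auto simp: F_def metric_inner_simps)
  then have "E v w = 0" by (rule metric_inner_cancel[OF c(2) x(2)])
  then show ?thesis by (simp add: E_def algebra_simps)
qed

lemma chart_preimage_open:
  assumes "open I" "continuous_map (top_of_set I) N \<eta>" "c \<in> A"
  shows "open {x \<in> I. \<eta> x \<in> dom_of c}"
proof -
  have "openin (top_of_set I) {x \<in> topspace (top_of_set I). \<eta> x \<in> dom_of c}"
    using openin_continuous_map_preimage[OF assms(2) chart_dom[OF assms(3)]] .
  then show ?thesis using assms(1) by (simp add: openin_open_eq)
qed

lemma velocity_transform:
  assumes c: "c \<in> A" "c' \<in> A" and T: "open T" "t \<in> T" "\<And>s. s \<in> T \<Longrightarrow> \<eta> s \<in> dom_of c \<inter> dom_of c'"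
    and sm: "smooth_on T (coord c \<circ> \<eta>)"
  shows "velocity \<eta> c' t = frechet_derivative (transition c c') (at (coord c (\<eta> t))) (velocity \<eta> c t)"
proof -
  have "((coord c \<circ> \<eta>) has_vector_derivative velocity \<eta> c t) (at t)"
    unfolding velocity_def by (rule smooth_on_has_vector_derivative[OF sm T(2)])
  then have "((\<lambda>s. transition c c' ((coord c \<circ> \<eta>) s)) has_vector_derivative
      frechet_derivative (transition c c') (at ((coord c \<circ> \<eta>) t)) (velocity \<eta> c t)) (at t)"
    by (intro smooth_on_chain[where y = "coord c \<circ> \<eta>", OF transition_smooth[OF c]]) (use T in auto)
  then have "((coord c' \<circ> \<eta>) has_vector_derivative
      frechet_derivative (transition c c') (at ((coord c \<circ> \<eta>) t)) (velocity \<eta> c t)) (at t)"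
    by (rule has_vector_derivative_transform_within_open[OF _ T(1,2)])
      (use T(3) transition_coord[OF c(1)] in auto)
  then show ?thesis unfolding velocity_def[of \<eta> c'] by (simp add: vector_derivative_at)
qed

text \<open>Differentiating the transformation law of \<open>V\<close> produces a second derivative
  of the transition map, and this is exactly the inhomogeneous term in
  \<open>chris_transform\<close>.\<close>

lemma cov_deriv_transform:
  assumes c: "c \<in> A" "c' \<in> A" and T: "open T" "t \<in> T" "\<And>s. s \<in> T \<Longrightarrow> \<eta> s \<in> dom_of c \<inter> dom_of c'"
    and sm: "smooth_on T (coord c \<circ> \<eta>)" "smooth_on T (V c)"
    and V: "\<And>s. s \<in> T \<Longrightarrow> V c' s = frechet_derivative (transition c c') (at (coord c (\<eta> s))) (V c s)"
  shows "cov_deriv g \<eta> V c' t =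
    frechet_derivative (transition c c') (at (coord c (\<eta> t))) (cov_deriv g \<eta> V c t)"
proof -
  let ?S = "coord c ` (dom_of c \<inter> dom_of c')"
  let ?J = "frechet_derivative (transition c c') (at (coord c (\<eta> t)))"
  have S: "coord c (\<eta> t) \<in> ?S" using T by blast
  have L: "linear ?J"
    using linear_frechet[OF smooth_on_differentiable[OF transition_smooth[OF c] S]] .
  have y: "((coord c \<circ> \<eta>) has_vector_derivative velocity \<eta> c t) (at t)"
    unfolding velocity_def by (rule smooth_on_has_vector_derivative[OF sm(1) T(2)])
  note Vd = smooth_on_has_vector_derivative[OF sm(2) T(2)]
  have "(V c' has_vector_derivative ?J (vector_derivative (V c) (at t)) +
      frechet_derivative (\<lambda>p. frechet_derivative (transition c c') (at p) (V c t)) (at (coord c (\<eta> t)))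
        (velocity \<eta> c t)) (at t)"
    by (rule has_vector_derivative_transform_within_open[OF _ T(1,2)])
      (use frechet_apply_has_vector_derivative[OF overlap_open[OF c] transition_smooth[OF c] _ y Vd] S V in auto)
  then show ?thesis
    using chris_transform[OF c S, of "velocity \<eta> c t" "V c t"] V[OF T(2)]
      velocity_transform[where \<eta> = \<eta>, OF c T(1,2) _ sm(1)] T(3) transition_coord[OF c(1)] T(2)
    by (simp add: cov_deriv_chris vector_derivative_at linear_add[OF L])
qed

section \<open>Smooth vector fields along a curve\<close>

lemma smooth_field_transform:
  assumes "smooth_field_along A I \<eta> V" "c \<in> A" "c' \<in> A" "t \<in> I" "\<eta> t \<in> dom_of c" "\<eta> t \<in> dom_of c'"
  shows "V c' t = frechet_derivative (transition c c') (at (coord c (\<eta> t))) (V c t)"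
proof -
  have "\<forall>c\<in>A. \<forall>c'\<in>A. \<forall>t\<in>I. \<eta> t \<in> dom_of c \<inter> dom_of c' \<longrightarrow>
      V c' t = frechet_derivative (transition c c') (at (coord c (\<eta> t))) (V c t)"
    using assms(1) unfolding smooth_field_along_def by (rule conjunct2)
  from this[rule_format, OF assms(2-4)] show ?thesis using assms(5,6) by simp
qed

lemma smooth_field_smooth:
  "smooth_field_along A I \<eta> V \<Longrightarrow> c \<in> A \<Longrightarrow> smooth_on {t \<in> I. \<eta> t \<in> dom_of c} (V c)"
  unfolding smooth_field_along_def by (drule conjunct1) simp

lemma smooth_field_velocity:
  assumes I: "open I" and \<eta>: "smooth_into N A I \<eta>"
  shows "smooth_field_along A I \<eta> (velocity \<eta>)"
  unfolding smooth_field_along_def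
proof (intro conjI ballI impI)
  note o = chart_preimage_open[OF I \<eta>[unfolded smooth_into_def, THEN conjunct1]]
  have sm: "smooth_on {t \<in> I. \<eta> t \<in> dom_of c} (coord c \<circ> \<eta>)" if "c \<in> A" for c
    using \<eta> that by (simp add: smooth_into_def)
  fix c assume c: "c \<in> A"
  show "smooth_on {t \<in> I. \<eta> t \<in> dom_of c} (velocity \<eta> c)"
    unfolding velocity_def by (rule smooth_on_vector_derivative[OF o[OF c] sm[OF c]])
  fix c' t assume c': "c' \<in> A" and t: "t \<in> I" "\<eta> t \<in> dom_of c \<inter> dom_of c'"
  show "velocity \<eta> c' t = frechet_derivative (transition c c') (at (coord c (\<eta> t))) (velocity \<eta> c t)"
    by (rule velocity_transform[OF c c' open_Int[OF o[OF c] o[OF c']] _ _ smooth_on_subset[OF sm[OF c]]])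
      (use t in auto)
qed

lemma smooth_field_cov_deriv:
  assumes I: "open I" and \<eta>: "smooth_into N A I \<eta>" and V: "smooth_field_along A I \<eta> V"
  shows "smooth_field_along A I \<eta> (cov_deriv g \<eta> V)"
  unfolding smooth_field_along_def
proof (intro conjI ballI impI)
  note o = chart_preimage_open[OF I \<eta>[unfolded smooth_into_def, THEN conjunct1]]
  have sm: "smooth_on {t \<in> I. \<eta> t \<in> dom_of c} (coord c \<circ> \<eta>)"
      "smooth_on {t \<in> I. \<eta> t \<in> dom_of c} (velocity \<eta> c)"
      "smooth_on {t \<in> I. \<eta> t \<in> dom_of c} (V c)" if "c \<in> A" for c
    using \<eta> that smooth_field_smooth[OF smooth_field_velocity[OF I \<eta>] that] smooth_field_smooth[OF V that]
    by (simp_all add: smooth_into_def)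
  fix c assume c: "c \<in> A"
  show "smooth_on {t \<in> I. \<eta> t \<in> dom_of c} (cov_deriv g \<eta> V c)"
    unfolding cov_deriv_chris[abs_def]
    by (intro smooth_on_add smooth_on_vector_derivative o c sm smooth_on_chris[OF c o[OF c]])
      (use sm(1)[OF c] in \<open>auto simp: o_def\<close>)
  fix c' t assume c': "c' \<in> A" and t: "t \<in> I" "\<eta> t \<in> dom_of c \<inter> dom_of c'"
  show "cov_deriv g \<eta> V c' t =
      frechet_derivative (transition c c') (at (coord c (\<eta> t))) (cov_deriv g \<eta> V c t)"
  proof (rule cov_deriv_transform[OF c c' open_Int[OF o[OF c] o[OF c']]])
    let ?T = "{t \<in> I. \<eta> t \<in> dom_of c} \<inter> {t \<in> I. \<eta> t \<in> dom_of c'}"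
    show "t \<in> ?T" using t by simp
    show "smooth_on ?T (coord c \<circ> \<eta>)" "smooth_on ?T (V c)"
      by (auto intro!: smooth_on_subset[OF sm(1)[OF c]] smooth_on_subset[OF sm(3)[OF c]])
    fix s assume "s \<in> ?T"
    then show "\<eta> s \<in> dom_of c \<inter> dom_of c'"
      "V c' s = frechet_derivative (transition c c') (at (coord c (\<eta> s))) (V c s)"
      using smooth_field_transform[OF V c c', of s] by simp_all
  qed
qed

lemma smooth_field_iterate:
  assumes "open I" "smooth_into N A I \<eta>"
  shows "smooth_field_along A I \<eta> ((cov_deriv g \<eta> ^^ k) (velocity \<eta>))"
proof (induction k)
  case 0
  show ?case unfolding funpow_0 by (rule smooth_field_velocity[OF assms])
next
  case (Suc k)
  show ?case unfolding funpow.simps o_apply by (rule smooth_field_cov_deriv[OF assms Suc])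
qed

text \<open>\<open>chart_at\<close> makes an unspecified choice, but the transformation laws of the
  fields match that of the metric. This permits computing the energy of a varied curve in one
  prescribed chart.\<close>

lemma inner_along_chart:
  assumes "smooth_field_along A I \<eta> V" "smooth_field_along A I \<eta> W" "t \<in> I" "c \<in> A" "\<eta> t \<in> dom_of c"
  shows "inner_along A g \<eta> V W t = metric_inner g c (coord c (\<eta> t)) (V c t) (W c t)"
proof -
  define c' where "c' = chart_at A (\<eta> t)"
  have c': "c' \<in> A" "\<eta> t \<in> dom_of c'"
    using someI[of "\<lambda>c. c \<in> A \<and> \<eta> t \<in> dom_of c" c] assms(4,5) by (simp_all add: c'_def chart_at_def)
  have "metric_inner g c (coord c (\<eta> t)) (V c t) (W c t) =
      metric_inner g c' (coord c' (\<eta> t)) (V c' t) (W c' t)"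
    using metric_transform[OF assms(4) c'(1), of "coord c (\<eta> t)" "V c t" "W c t"] c'(2) assms(5)
      smooth_field_transform[OF assms(1,4) c'(1) assms(3,5) c'(2)]
      smooth_field_transform[OF assms(2,4) c'(1) assms(3,5) c'(2)]
    by (simp add: transition_coord[OF assms(4,5)])
  then show ?thesis by (simp add: inner_along_def c'_def Let_def)
qed

end

section \<open>Covariant derivatives of vector fields along maps into a chart\<close>

definition dchris :: "'a metric_family \<Rightarrow> 'a chart \<Rightarrow> real^2 \<Rightarrow> real^2 \<Rightarrow> real^2 \<Rightarrow> real^2 \<Rightarrow> real^2" where
  "dchris g c x a v w = (\<chi> k. \<Sum>i\<in>UNIV. \<Sum>j\<in>UNIV.
     frechet_derivative (christoffel g c k i j) (at x) a * v $ i * w $ j)"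

text \<open>Covariant differentiation along a map \<open>X\<close> of several variables, written in
  one chart. For a variation, the directions \<open>(1, 0)\<close> and \<open>(0, 1)\<close> give
  the covariant derivatives in the deformation parameter and in the curve parameter.\<close>

definition cov_dir :: "'a metric_family \<Rightarrow> 'a chart \<Rightarrow> ('b::euclidean_space \<Rightarrow> real^2) \<Rightarrow> 'b \<Rightarrow>
    ('b \<Rightarrow> real^2) \<Rightarrow> 'b \<Rightarrow> real^2" where
  "cov_dir g c X e W p =
     frechet_derivative W (at p) e + chris g c (X p) (frechet_derivative X (at p) e) (W p)"

lemma has_derivative_vecI:
  fixes f :: "'b::real_normed_vector \<Rightarrow> real^'n"
  assumes "\<And>k. ((\<lambda>p. f p $ k) has_derivative (\<lambda>h. f' h $ k)) (at p)"
  shows "(f has_derivative f') (at p)"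
  by (subst has_derivative_componentwise_within) (auto simp: Basis_vec_def inner_axis assms)

lemma has_derivative_nth:
  "(f has_derivative f') F \<Longrightarrow> ((\<lambda>p. f p $ k) has_derivative (\<lambda>h. f' h $ k)) F"
  by (rule bounded_linear.has_derivative[OF bounded_linear_vec_nth])

context riemannian_surface
begin

lemma chris_has_derivative:
  fixes X :: "'b::euclidean_space \<Rightarrow> real^2"
  assumes c: "c \<in> A" "X p \<in> img c"
    and X: "(X has_derivative X') (at p)" and V: "(V has_derivative V') (at p)"
    and W: "(W has_derivative W') (at p)"
  shows "((\<lambda>p. chris g c (X p) (V p) (W p)) has_derivative
    (\<lambda>h. dchris g c (X p) (X' h) (V p) (W p) + chris g c (X p) (V' h) (W p)
      + chris g c (X p) (V p) (W' h))) (at p)"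
proof (rule has_derivative_vecI)
  fix k
  have C: "((\<lambda>p. christoffel g c k i j (X p)) has_derivative
      (\<lambda>h. frechet_derivative (christoffel g c k i j) (at (X p)) (X' h))) (at p)" for i j
    by (rule has_derivative_compose[OF X smooth_on_has_derivative[OF christoffel_smooth[OF c(1)] c(2)]])
  have "((\<lambda>p. \<Sum>i\<in>UNIV. \<Sum>j\<in>UNIV. christoffel g c k i j (X p) * V p $ i * W p $ j) has_derivative
      (\<lambda>h. \<Sum>i\<in>UNIV. \<Sum>j\<in>UNIV. christoffel g c k i j (X p) * V p $ i * W' h $ j +
        (christoffel g c k i j (X p) * V' h $ i +
          frechet_derivative (christoffel g c k i j) (at (X p)) (X' h) * V p $ i) * W p $ j)) (at p)"
    by (intro has_derivative_sum has_derivative_mult C has_derivative_nth V W)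
  then show "((\<lambda>p. chris g c (X p) (V p) (W p) $ k) has_derivative
      (\<lambda>h. (dchris g c (X p) (X' h) (V p) (W p) + chris g c (X p) (V' h) (W p)
        + chris g c (X p) (V p) (W' h)) $ k)) (at p)"
    by (simp add: chris_def dchris_def sum.distrib algebra_simps)
qed

text \<open>Brings the coefficient definition into the bilinear form in which curvature emerges from
  commuting covariant derivatives.\<close>

lemma riemann_formula:
  assumes "c \<in> A" "x \<in> img c"
  shows "riemann g c x a b w = dchris g c x a b w - dchris g c x b a w +
    chris g c x a (chris g c x b w) - chris g c x b (chris g c x a w)"
proof -
  have "frechet_derivative (christoffel g c k i j) (at x) v =
      v $ 1 * partial 1 (christoffel g c k i j) x + v $ 2 * partial 2 (christoffel g c k i j) x" for k i j v
  proof -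
    have L: "linear (frechet_derivative (christoffel g c k i j) (at x))"
      by (rule linear_frechet[OF smooth_on_differentiable[OF christoffel_smooth[OF assms(1)] assms(2)]])
    have "v = v $ 1 *\<^sub>R axis 1 1 + v $ 2 *\<^sub>R axis 2 1"
      by (simp add: vec_eq_iff forall_2 axis_def)
    then have "frechet_derivative (christoffel g c k i j) (at x) v =
        frechet_derivative (christoffel g c k i j) (at x) (v $ 1 *\<^sub>R axis 1 1 + v $ 2 *\<^sub>R axis 2 1)" by simp
    then show ?thesis by (simp add: linear_add[OF L] linear_scale[OF L] partial_def)
  qed
  then show ?thesis
    by (simp add: vec_eq_iff riemann_def riemann_coeff_def dchris_def chris_def sum_2 algebra_simps)
qed

lemma smooth_cov_dir:
  assumes "c \<in> A" "open D" "X ` D \<subseteq> img c" "smooth_on D X" "smooth_on D W"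
  shows "smooth_on D (cov_dir g c X e W)"
  unfolding cov_dir_def[abs_def]
  by (intro smooth_on_add assms smooth_on_frechet smooth_on_chris[OF assms(1-3)])

text \<open>Equality of mixed derivatives of \<open>X\<close> together with symmetry of the
  connection. It turns the transversal derivative of the velocity into the derivative of the
  variation field along the curve.\<close>

lemma cov_dir_torsion_free:
  assumes "c \<in> A" "open D" "X ` D \<subseteq> img c" "smooth_on D X" "p \<in> D"
  shows "cov_dir g c X e (\<lambda>p. frechet_derivative X (at p) f) p =
    cov_dir g c X f (\<lambda>p. frechet_derivative X (at p) e) p"
proof -
  have "X p \<in> img c" using assms by blast
  then show ?thesis
    using second_derivative_symmetric[OF assms(2,4,5)] chris_sym[OF assms(1)]
    by (simp add: cov_dir_def)
qed

text \<open>The mixed second derivatives of \<open>X\<close> and \<open>W\<close> cancel, and what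
  remains is curvature. The directions are constant, so no bracket term appears.\<close>

lemma cov_dir_commute:
  assumes "c \<in> A" "open D" "X ` D \<subseteq> img c" "smooth_on D X" "smooth_on D W" "p \<in> D"
  shows "cov_dir g c X e (cov_dir g c X f W) p = cov_dir g c X f (cov_dir g c X e W) p +
    riemann g c (X p) (frechet_derivative X (at p) e) (frechet_derivative X (at p) f) (W p)"
proof -
  have x: "X p \<in> img c" using assms by blast
  let ?dX = "\<lambda>e p. frechet_derivative X (at p) e" and ?dW = "\<lambda>e p. frechet_derivative W (at p) e"
  have D: "frechet_derivative (cov_dir g c X f W) (at p) e =
      frechet_derivative (?dW f) (at p) e + (dchris g c (X p) (?dX e p) (?dX f p) (W p) +
        chris g c (X p) (frechet_derivative (?dX f) (at p) e) (W p) + chris g c (X p) (?dX f p) (?dW e p))" for e f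
  proof -
    note d = smooth_on_has_derivative[OF _ assms(6)]
    have "(cov_dir g c X f W has_derivative (\<lambda>h. frechet_derivative (?dW f) (at p) h +
        (dchris g c (X p) (?dX h p) (?dX f p) (W p) +
        chris g c (X p) (frechet_derivative (?dX f) (at p) h) (W p) + chris g c (X p) (?dX f p) (?dW h p)))) (at p)"
      unfolding cov_dir_def[abs_def]
      by (intro has_derivative_add chris_has_derivative[OF assms(1)] x d smooth_on_frechet assms)
    then show ?thesis by (simp add: frechet_derivative_eqI)
  qed
  show ?thesis
    unfolding cov_dir_def[of g c X e "cov_dir g c X f W"] cov_dir_def[of g c X f "cov_dir g c X e W"]
      D riemann_formula[OF assms(1) x]
    using second_derivative_symmetric[OF assms(2,4,6), of e f] second_derivative_symmetric[OF assms(2,5,6), of e f]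
    by (simp add: cov_dir_def[of g c X _ W] chris_simps)
qed

section \<open>The curvature tensor in an orthonormal frame\<close>

lemma riemann_antisym: "riemann g c x Y X Z = - riemann g c x X Y Z"
  by (simp add: vec_eq_iff riemann_def riemann_coeff_def sum_2 algebra_simps)

lemma riemann_add_scale:
  "riemann g c x X (a *\<^sub>R Y + b *\<^sub>R Y') Z = a *\<^sub>R riemann g c x X Y Z + b *\<^sub>R riemann g c x X Y' Z"
  "riemann g c x X Y (a *\<^sub>R Z + b *\<^sub>R Z') = a *\<^sub>R riemann g c x X Y Z + b *\<^sub>R riemann g c x X Y Z'"
  "riemann g c x (a *\<^sub>R X) Y Z = a *\<^sub>R riemann g c x X Y Z"
  by (simp_all add: vec_eq_iff riemann_def sum_2 algebra_simps)

lemma riemann_self: "riemann g c x X X Z = 0"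
  using riemann_antisym[of c x X X Z] by (simp add: vec_eq_iff)

text \<open>The Gram determinant is the determinant of the metric times the square of this
  coordinate determinant, and it equals 1 for an orthonormal pair.\<close>

lemma orthonormal_cross:
  assumes "metric_inner g c x T T = 1" "metric_inner g c x \<nu> \<nu> = 1" "metric_inner g c x \<nu> T = 0"
    "c \<in> A" "x \<in> img c"
  shows "T $ 1 * \<nu> $ 2 - T $ 2 * \<nu> $ 1 \<noteq> 0"
proof
  assume *: "T $ 1 * \<nu> $ 2 - T $ 2 * \<nu> $ 1 = 0"
  have "metric_inner g c x T T * metric_inner g c x \<nu> \<nu> - metric_inner g c x T \<nu> * metric_inner g c x \<nu> T =
      det (g c x) * (T $ 1 * \<nu> $ 2 - T $ 2 * \<nu> $ 1)\<^sup>2"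
    by (simp add: metric_inner_expand sum_2 det_2 power2_eq_square algebra_simps)
  then show False using assms * by simp
qed

lemma independent_2:
  fixes X Y :: "real^2"
  assumes "X $ 1 * Y $ 2 - X $ 2 * Y $ 1 \<noteq> 0"
  shows "X \<noteq> Y" "independent {X, Y}"
proof -
  show "X \<noteq> Y" using assms by auto
  have "X \<notin> span {Y}" using assms by (auto simp: span_singleton)
  moreover have "Y \<noteq> 0" using assms by auto
  ultimately show "independent {X, Y}" by (simp add: independent_insert)
qed

text \<open>Evaluating the sectional curvature on \<open>{\<nu>, T}\<close>, \<open>{\<nu>, T + \<nu>}\<close>, \<open>{T, \<nu>}\<close> and \<open>{T, \<nu> + T}\<close>
  determines all components of the curvature tensor without using its symmetries.\<close>

lemma riemann_constant_curvature:
  assumes K: "constant_sectional_curvature A g K" and c: "c \<in> A" "x \<in> img c"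
    and on: "metric_inner g c x T T = 1" "metric_inner g c x \<nu> \<nu> = 1" "metric_inner g c x \<nu> T = 0"
  shows "riemann g c x (r *\<^sub>R \<nu>) T (a *\<^sub>R T + b *\<^sub>R \<nu>) = (r * K) *\<^sub>R (a *\<^sub>R \<nu> - b *\<^sub>R T)"
proof -
  let ?m = "metric_inner g c x" and ?R = "riemann g c x"
  note cr = orthonormal_cross[OF on c]
  have on': "?m T \<nu> = 0" using on metric_inner_sym[OF c] by simp
  have sec: "?m (?R X Y Y) X = K * (?m X X * ?m Y Y - (?m X Y)\<^sup>2)"
    if "X $ 1 * Y $ 2 - X $ 2 * Y $ 1 \<noteq> 0" "?m X X * ?m Y Y - (?m X Y)\<^sup>2 = 1" for X Y
  proof -
    have "sectional g c x X Y = K"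
      using K c independent_2[OF that(1)] unfolding constant_sectional_curvature_def by blast
    then show ?thesis using that(2) by (simp add: sectional_def)
  qed
  have 1: "?m (?R \<nu> T T) \<nu> = K" using sec[of \<nu> T] cr on on' by (simp add: algebra_simps)
  have 2: "?m (?R T \<nu> \<nu>) T = K" using sec[of T \<nu>] cr on on' by (simp add: algebra_simps)
  \<comment> \<open>The sheared pair again has Gram determinant 1 and \<open>?R \<nu> \<nu>\<close>
    vanishes, so comparison with the value on \<open>\<nu>\<close>, \<open>T\<close> isolates one
    mixed component. The coefficients 1 are written out to match
    \<open>riemann_add_scale\<close>.\<close>
  have "?m (?R \<nu> (1 *\<^sub>R T + 1 *\<^sub>R \<nu>) (1 *\<^sub>R T + 1 *\<^sub>R \<nu>)) \<nu> = K"
    using sec[of \<nu> "1 *\<^sub>R T + 1 *\<^sub>R \<nu>"] cr on on' by (simp add: algebra_simps metric_inner_simps)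
  then have 3: "?m (?R \<nu> T \<nu>) \<nu> = 0"
    unfolding riemann_add_scale by (simp add: riemann_self metric_inner_simps 1)
  have "?m (?R T (1 *\<^sub>R \<nu> + 1 *\<^sub>R T) (1 *\<^sub>R \<nu> + 1 *\<^sub>R T)) T = K"
    using sec[of T "1 *\<^sub>R \<nu> + 1 *\<^sub>R T"] cr on on' by (simp add: algebra_simps metric_inner_simps)
  then have 4: "?m (?R T \<nu> T) T = 0"
    unfolding riemann_add_scale by (simp add: riemann_self metric_inner_simps 2)
  have basis: "v = w" if "?m v T = ?m w T" "?m v \<nu> = ?m w \<nu>" for v w
  proof (rule metric_inner_cancel[OF c])
    fix z :: "real^2"
    define d where "d = T $ 1 * \<nu> $ 2 - T $ 2 * \<nu> $ 1"
    \<comment> \<open>Cramer's rule in the basis \<open>T\<close>, \<open>\<nu>\<close>.\<close>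
    have "z = ((z $ 1 * \<nu> $ 2 - z $ 2 * \<nu> $ 1) / d) *\<^sub>R T + ((T $ 1 * z $ 2 - T $ 2 * z $ 1) / d) *\<^sub>R \<nu>"
      using cr unfolding d_def[symmetric]
      by (simp add: vec_eq_iff forall_2 field_simps) (simp add: d_def algebra_simps)
    then obtain p q where "z = p *\<^sub>R T + q *\<^sub>R \<nu>" by blast
    then show "?m v z = ?m w z" using that by (simp add: metric_inner_simps)
  qed
  have "?R \<nu> T T = K *\<^sub>R \<nu>"
    by (rule basis)
      (use 1 4 on on' riemann_antisym[of c x T \<nu> T] in \<open>simp_all add: metric_inner_simps\<close>)
  moreover have "?R \<nu> T \<nu> = - K *\<^sub>R T"
    by (rule basis)
      (use 2 3 on on' riemann_antisym[of c x T \<nu> \<nu>] in \<open>simp_all add: metric_inner_simps\<close>)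
  ultimately show ?thesis
    by (simp add: riemann_add_scale algebra_simps)
qed

end

section \<open>A bump function\<close>

text \<open>The exponent makes the family closed under differentiation up to linear combinations, so
  smoothness follows by one induction over all members at once; \<open>flat 0\<close> is the
  classical flat function.\<close>

definition flat :: "nat \<Rightarrow> real \<Rightarrow> real" where
  "flat k x = (if x > 0 then exp (- inverse x) * inverse x ^ k else 0)"

text \<open>The term of index \<open>k + n\<close> of the exponential series at
  \<open>inverse x\<close> is at most the whole series.\<close>

lemma flat_bound: "\<bar>flat k x\<bar> \<le> fact (k + n) * \<bar>x\<bar> ^ n"
proof (cases "x > 0")
  case True
  have "inverse x ^ (k + n) / fact (k + n) \<le> exp (inverse x)"
  proof -
    have "(\<Sum>i\<in>{k + n}. inverse x ^ i /\<^sub>R fact i) \<le> (\<Sum>i. inverse x ^ i /\<^sub>R fact i)"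
      using True by (intro sum_le_suminf summable_exp_generic) auto
    then show ?thesis by (simp add: exp_def divide_inverse mult.commute)
  qed
  then have "inverse x ^ (k + n) \<le> fact (k + n) * exp (inverse x)"
    by (simp add: divide_le_eq mult.commute)
  then have "inverse x ^ (k + n) * exp (- inverse x) \<le> fact (k + n) * exp (inverse x) * exp (- inverse x)"
    by (rule mult_right_mono) simp
  then have "inverse x ^ (k + n) * exp (- inverse x) \<le> fact (k + n)"
    by (simp add: mult.assoc exp_add[symmetric])
  then have "inverse x ^ (k + n) * exp (- inverse x) * x ^ n \<le> fact (k + n) * x ^ n"
    by (rule mult_right_mono) (use True in simp)
  moreover have "inverse x ^ (k + n) * exp (- inverse x) * x ^ n =
      inverse x ^ k * exp (- inverse x) * (inverse x * x) ^ n"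
    by (simp add: power_add power_mult_distrib del: left_inverse)
  ultimately have "inverse x ^ k * exp (- inverse x) \<le> fact (k + n) * x ^ n"
    using True by simp
  then show ?thesis using True by (simp add: flat_def mult.commute)
qed (simp add: flat_def)

lemma flat_has_derivative:
  "(flat k has_real_derivative flat (k + 2) x - real k * flat (k + 1) x) (at x)"
proof -
  consider "x > 0" | "x < 0" | "x = 0" by linarith
  then show ?thesis
  proof cases
    case 1
    have "((\<lambda>x. exp (- inverse x) * inverse x ^ k) has_real_derivative
        flat (k + 2) x - real k * flat (k + 1) x) (at x)"
    proof -
      have i: "(inverse has_real_derivative - (inverse x ^ 2)) (at x)"
        using DERIV_inverse[of x] 1 by (simp add: power2_eq_square)
      have e: "((\<lambda>x. exp (- inverse x)) has_real_derivative exp (- inverse x) * inverse x ^ 2) (at x)"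
        using DERIV_chain2[OF DERIV_exp DERIV_minus[OF i]] by simp
      have p: "((\<lambda>x. inverse x ^ k) has_real_derivative real k * (- (inverse x ^ 2) * inverse x ^ (k - 1))) (at x)"
        using DERIV_power[OF i, of k] by simp
      have k: "real k * (inverse x ^ 2 * inverse x ^ (k - 1)) = real k * inverse x ^ (k + 1)"
        by (cases k) (simp_all add: power2_eq_square)
      have "exp (- inverse x) * inverse x ^ 2 * inverse x ^ k +
          real k * (- (inverse x ^ 2) * inverse x ^ (k - 1)) * exp (- inverse x) =
          exp (- inverse x) * inverse x ^ (k + 2) - (real k * (inverse x ^ 2 * inverse x ^ (k - 1))) * exp (- inverse x)"
        by (simp add: power_add power2_eq_square)
      also have "\<dots> = flat (k + 2) x - real k * flat (k + 1) x"
        unfolding k using 1 by (simp add: flat_def)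
      finally show ?thesis using DERIV_mult[OF e p] by simp
    qed
    then show ?thesis
      by (rule has_field_derivative_transform_within_open[of _ _ _ "{0<..}"]) (use 1 in \<open>auto simp: flat_def\<close>)
  next
    case 2
    have "((\<lambda>x. 0) has_real_derivative flat (k + 2) x - real k * flat (k + 1) x) (at x)"
      using 2 by (simp add: flat_def)
    then show ?thesis
      by (rule has_field_derivative_transform_within_open[of _ _ _ "{..<0}"]) (use 2 in \<open>auto simp: flat_def\<close>)
  next
    case 3
    \<comment> \<open>The bound with \<open>n = 2\<close> leaves one factor \<open>h\<close> after
      division, so the difference quotient at 0 tends to 0.\<close>
    have "((\<lambda>h. (flat k (0 + h) - flat k 0) / h) \<longlongrightarrow> 0) (at 0)"
    proof (rule Lim_null_comparison)
      show "\<forall>\<^sub>F h in at 0. norm ((flat k (0 + h) - flat k 0) / h) \<le> fact (k + 2) * \<bar>h\<bar>"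
      proof (rule always_eventually, rule allI)
        fix h :: real
        show "norm ((flat k (0 + h) - flat k 0) / h) \<le> fact (k + 2) * \<bar>h\<bar>"
          using flat_bound[of k h 2]
          by (cases "h = 0") (simp_all add: flat_def[of k 0] abs_divide divide_le_eq power2_eq_square mult.assoc)
      qed
      show "((\<lambda>h. fact (k + 2) * \<bar>h\<bar>) \<longlongrightarrow> 0) (at (0::real))"
        by (intro tendsto_eq_intros) auto
    qed
    then show ?thesis using 3 by (simp add: DERIV_def flat_def)
  qed
qed

lemma smooth_flat: "smooth_on UNIV (flat k)"
proof -
  have "Ck_on m UNIV (flat k)" for m
  proof (induction m arbitrary: k)
    case 0
    show ?case
      using DERIV_isCont[OF flat_has_derivative] by (auto intro!: continuous_at_imp_continuous_on)
  next
    case (Suc m)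
    have D: "(flat k has_derivative (*) (flat (k + 2) x - real k * flat (k + 1) x)) (at x)" for x
      using flat_has_derivative[of k x] by (simp add: has_field_derivative_def)
    have "Ck_on m UNIV (\<lambda>x. frechet_derivative (flat k) (at x) v)" for v
    proof -
      have "Ck_on m UNIV (\<lambda>x. flat (k + 2) x * v + flat (k + 1) x * (- real k * v))"
        by (intro Ck_on_add Ck_on_bilinear[OF _ bounded_bilinear_mult] Ck_on_const Suc open_UNIV)
      then show ?thesis by (simp add: frechet_derivative_eqI[OF D] algebra_simps)
    qed
    then show ?case using D by (auto simp: differentiable_def)
  qed
  then show ?thesis by (simp add: smooth_on_def)
qed

text \<open>One flat function for each endpoint. Positivity inside the interval later ensures that
  the bump has nonzero integral.\<close>

lemma bump_function:
  fixes a b :: real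
  shows "\<exists>\<phi>. smooth_on UNIV \<phi> \<and> (\<forall>t. t \<notin> {a<..<b} \<longrightarrow> \<phi> t = 0) \<and> (\<forall>t\<in>{a<..<b}. \<phi> t > (0::real))"
proof (intro exI conjI)
  have aff: "smooth_on UNIV (\<lambda>t. t - a)" "smooth_on UNIV (\<lambda>t. b - t)"
    by (intro smooth_on_diff smooth_on_const smooth_on_linear bounded_linear_ident open_UNIV)+
  show "smooth_on UNIV (\<lambda>t. flat 0 (t - a) * flat 0 (b - t))"
    by (intro smooth_on_mult open_UNIV smooth_on_compose[OF _ _ smooth_flat] aff) auto
qed (auto simp: flat_def)

section \<open>Variations supported in a chart\<close>

lemma slice_has_vector_derivative:
  fixes F :: "real \<times> real \<Rightarrow> 'c::real_normed_vector"
  assumes "smooth_on D F" "(u, t) \<in> D"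
  shows "((\<lambda>s. F (u, s)) has_vector_derivative frechet_derivative F (at (u, t)) (0, 1)) (at t)"
    and "((\<lambda>s. F (s, t)) has_vector_derivative frechet_derivative F (at (u, t)) (1, 0)) (at u)"
proof -
  have "((\<lambda>s. (u, s)) has_vector_derivative (0, 1)) (at t)"
    by (intro has_vector_derivative_Pair derivative_intros)
  then show "((\<lambda>s. F (u, s)) has_vector_derivative frechet_derivative F (at (u, t)) (0, 1)) (at t)"
    by (rule smooth_on_chain[where y = "\<lambda>s. (u, s)", OF assms])
  have "((\<lambda>s. (s, t)) has_vector_derivative (1, 0)) (at u)"
    by (intro has_vector_derivative_Pair derivative_intros)
  then show "((\<lambda>s. F (s, t)) has_vector_derivative frechet_derivative F (at (u, t)) (1, 0)) (at u)"
    by (rule smooth_on_chain[where y = "\<lambda>s. (s, t)", OF assms])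
qed

lemma smooth_on_snd: "open D \<Longrightarrow> smooth_on T f \<Longrightarrow> snd ` D \<subseteq> T \<Longrightarrow> smooth_on D (\<lambda>p. f (snd p))"
  for f :: "real \<Rightarrow> 'c::real_normed_vector" and D :: "(real \<times> real) set"
  by (rule smooth_on_compose[OF _ _ _ smooth_on_linear[OF _ bounded_linear_snd]])

context riemannian_surface
begin

lemma smooth_into_slice:
  fixes \<Gamma> :: "real \<times> real \<Rightarrow> 'a"
  assumes \<Gamma>: "smooth_into N A (U \<times> I) \<Gamma>" and "open I" "u \<in> U"
  shows "smooth_into N A I (\<lambda>t. \<Gamma> (u, t))"
proof -
  have "continuous_map (top_of_set I) (top_of_set (U \<times> I)) (Pair u)"
    using assms(3) by (auto simp: continuous_map_in_subtopology intro!: continuous_intros)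
  then have cont: "continuous_map (top_of_set I) N (\<lambda>t. \<Gamma> (u, t))"
    using continuous_map_compose[of _ _ "Pair u" N \<Gamma>] \<Gamma> unfolding smooth_into_def o_def by blast
  have "smooth_on {t \<in> I. \<Gamma> (u, t) \<in> dom_of c} (coord c \<circ> (\<lambda>t. \<Gamma> (u, t)))" if c: "c \<in> A" for c
  proof -
    note o = chart_preimage_open[OF assms(2) cont c]
    have "smooth_on {p \<in> U \<times> I. \<Gamma> p \<in> dom_of c} (coord c \<circ> \<Gamma>)"
      using \<Gamma> c by (simp add: smooth_into_def)
    moreover have "smooth_on {t \<in> I. \<Gamma> (u, t) \<in> dom_of c} (\<lambda>t. (u, 0) + (0, t))"
      by (intro smooth_on_add smooth_on_const smooth_on_linear o bounded_linear_Pair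
          bounded_linear_zero bounded_linear_ident)
    ultimately have "smooth_on {t \<in> I. \<Gamma> (u, t) \<in> dom_of c} (\<lambda>t. (coord c \<circ> \<Gamma>) ((u, 0) + (0, t)))"
      by (rule smooth_on_compose[OF o, rotated]) (use assms(3) in auto)
    then show ?thesis by (simp add: o_def)
  qed
  then show ?thesis using cont by (simp add: smooth_into_def)
qed

lemma velocity_in_chart:
  fixes X :: "real \<times> real \<Rightarrow> real^2"
  assumes "smooth_on D X" "open J" "\<And>t. t \<in> J \<Longrightarrow> (u, t) \<in> D \<and> coord c (\<eta> t) = X (u, t)" "t \<in> J"
  shows "velocity \<eta> c t = frechet_derivative X (at (u, t)) (0, 1)"
proof -
  have "((\<lambda>s. X (u, s)) has_vector_derivative frechet_derivative X (at (u, t)) (0, 1)) (at t)"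
    by (rule slice_has_vector_derivative[OF assms(1)]) (use assms in blast)
  then have "((coord c \<circ> \<eta>) has_vector_derivative frechet_derivative X (at (u, t)) (0, 1)) (at t)"
    by (rule has_vector_derivative_transform_within_open[OF _ assms(2,4)]) (use assms(3) in simp)
  then show ?thesis by (simp add: velocity_def vector_derivative_at)
qed

lemma smooth_cov_dir_iterate:
  assumes "c \<in> A" "open D" "X ` D \<subseteq> img c" "smooth_on D X"
  shows "smooth_on D ((cov_dir g c X e ^^ j) (\<lambda>p. frechet_derivative X (at p) f))"
proof (induction j)
  case 0
  show ?case unfolding funpow_0 by (rule smooth_on_frechet[OF assms(4)])
next
  case (Suc j)
  show ?case unfolding funpow.simps o_apply by (rule smooth_cov_dir[OF assms Suc])
qed

text \<open>Bridge between the energy, which sees one curve at a time, and the calculus in two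
  parameters. Derivatives at \<open>t\<close> depend only on nearby values, so a coordinate
  description over the open set \<open>J\<close> suffices.\<close>

lemma iterate_in_chart:
  fixes X :: "real \<times> real \<Rightarrow> real^2"
  assumes "c \<in> A" "open D" "X ` D \<subseteq> img c" "smooth_on D X"
    and "open J" "\<And>t. t \<in> J \<Longrightarrow> (u, t) \<in> D \<and> coord c (\<eta> t) = X (u, t)" "t \<in> J"
  shows "(cov_deriv g \<eta> ^^ j) (velocity \<eta>) c t =
    (cov_dir g c X (0, 1) ^^ j) (\<lambda>p. frechet_derivative X (at p) (0, 1)) (u, t)"
  using assms(7)
proof (induction j arbitrary: t)
  case 0
  show ?case unfolding funpow_0 by (rule velocity_in_chart[OF assms(4-6) 0])
next
  case (Suc j)
  let ?W = "(cov_dir g c X (0, 1) ^^ j) (\<lambda>p. frechet_derivative X (at p) (0, 1))"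
  let ?V = "(cov_deriv g \<eta> ^^ j) (velocity \<eta>)"
  have ut: "(u, t) \<in> D" using assms(6) Suc.prems by blast
  have "((\<lambda>s. ?W (u, s)) has_vector_derivative frechet_derivative ?W (at (u, t)) (0, 1)) (at t)"
    by (rule slice_has_vector_derivative[OF smooth_cov_dir_iterate[OF assms(1-4)] ut])
  then have "(?V c has_vector_derivative frechet_derivative ?W (at (u, t)) (0, 1)) (at t)"
    by (rule has_vector_derivative_transform_within_open[OF _ assms(5) Suc.prems]) (simp add: Suc.IH)
  then have "cov_deriv g \<eta> ?V c t = cov_dir g c X (0, 1) ?W (u, t)"
    using assms(6)[OF Suc.prems] Suc.IH[OF Suc.prems] velocity_in_chart[OF assms(4-6) Suc.prems]
    by (simp add: cov_deriv_chris[of g \<eta> ?V] cov_dir_def[of g c X _ ?W] vector_derivative_at)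
  then show ?case by simp
qed

text \<open>Straight segments in coordinates take the place of geodesics, since a first variation
  depends only on the variation field, here \<open>\<phi> t *\<^sub>R \<nu> t\<close>. The work lies
  in smoothness beyond the chart: \<open>\<Gamma>\<close> is glued from this family over
  \<open>J\<close> and the unchanged curve off \<open>{a..b}\<close>.\<close>

lemma chart_variation:
  fixes \<gamma> :: "real \<Rightarrow> 'a" and \<nu> :: "real \<Rightarrow> real^2" and \<phi> :: "real \<Rightarrow> real"
  assumes I: "open I" and \<gamma>: "smooth_into N A I \<gamma>" and c: "c \<in> A"
    and J: "J = {t \<in> I. \<gamma> t \<in> dom_of c}" and \<nu>: "smooth_on J \<nu>"
    and ab: "{a..b} \<subseteq> J" and \<phi>: "smooth_on UNIV \<phi>" "\<And>t. t \<notin> {a..b} \<Longrightarrow> \<phi> t = 0"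
  defines "X \<equiv> \<lambda>p. coord c (\<gamma> (snd p)) + (fst p * \<phi> (snd p)) *\<^sub>R \<nu> (snd p)"
  shows "\<exists>\<epsilon> \<Gamma>. variation N A I \<gamma> {a..b} \<epsilon> \<Gamma> \<and>
    smooth_on ({-\<epsilon><..<\<epsilon>} \<times> J) X \<and> X ` ({-\<epsilon><..<\<epsilon>} \<times> J) \<subseteq> img c \<and>
    (\<forall>p \<in> {-\<epsilon><..<\<epsilon>} \<times> J. \<Gamma> p \<in> dom_of c \<and> coord c (\<Gamma> p) = X p)"
proof -
  have \<gamma>_cont: "continuous_map (top_of_set I) N \<gamma>" using \<gamma> by (simp add: smooth_into_def)
  have oJ: "open J" unfolding J by (rule chart_preimage_open[OF I \<gamma>_cont c])
  have x_sm: "smooth_on J (\<lambda>t. coord c (\<gamma> t))"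
    using \<gamma> c by (simp add: J smooth_into_def o_def)
  have \<phi>\<nu>: "smooth_on J (\<lambda>t. \<phi> t *\<^sub>R \<nu> t)"
    by (intro smooth_on_scaleR oJ \<nu> smooth_on_subset[OF \<phi>(1)]) simp
  have "compact ((\<lambda>t. coord c (\<gamma> t)) ` {a..b})"
    by (intro compact_continuous_image compact_Icc continuous_on_subset[OF smooth_on_continuous_on[OF x_sm] ab])
  moreover have "(\<lambda>t. coord c (\<gamma> t)) ` {a..b} \<subseteq> img c" using ab J by auto
  ultimately obtain e where e: "e > 0" "(\<Union>y\<in>(\<lambda>t. coord c (\<gamma> t)) ` {a..b}. ball y e) \<subseteq> img c"
    using compact_subset_open_imp_ball_epsilon_subset[OF _ chart_image[OF c]] by blast
  have "compact ((\<lambda>t. \<phi> t *\<^sub>R \<nu> t) ` {a..b})"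
    by (intro compact_continuous_image compact_Icc continuous_on_subset[OF smooth_on_continuous_on[OF \<phi>\<nu>] ab])
  then obtain M where M: "M > 0" "\<And>t. t \<in> {a..b} \<Longrightarrow> norm (\<phi> t *\<^sub>R \<nu> t) \<le> M"
    using compact_imp_bounded bounded_pos by (metis (no_types, lifting) imageI)
  \<comment> \<open>Balls of radius \<open>e\<close> around the compact coordinate arc stay in
    \<open>img c\<close>, and \<open>M\<close> bounds the displacement per unit of the deformation
    parameter; hence \<open>X\<close> does not leave the chart.\<close>
  define \<epsilon> where "\<epsilon> = e / M"
  have \<epsilon>: "\<epsilon> > 0" using e M by (simp add: \<epsilon>_def)
  let ?U = "{-\<epsilon><..<\<epsilon>}"
  let ?D = "?U \<times> J"
  have oD: "open ?D" by (intro open_Times oJ) auto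
  have X0: "X p = coord c (\<gamma> (snd p))" if "\<phi> (snd p) = 0" for p using that by (simp add: X_def)
  have X_img: "X p \<in> img c" if p: "p \<in> ?D" for p
  proof (cases "snd p \<in> {a..b}")
    case True
    have "norm (fst p *\<^sub>R (\<phi> (snd p) *\<^sub>R \<nu> (snd p))) \<le> \<bar>fst p\<bar> * M"
      unfolding norm_scaleR[of "fst p"] by (rule mult_left_mono[OF M(2)[OF True]]) simp
    also have "\<dots> < \<epsilon> * M" using p M by (auto simp: abs_less_iff)
    also have "\<dots> = e" using M by (simp add: \<epsilon>_def)
    finally have "X p \<in> ball (coord c (\<gamma> (snd p))) e" by (simp add: X_def dist_norm)
    then show ?thesis using e(2) True by blast
  next
    case False
    then show ?thesis using X0[of p] \<phi>(2) p by (auto simp: J)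
  qed
  have X_sm: "smooth_on ?D X"
    unfolding X_def
    by (intro smooth_on_add smooth_on_scaleR smooth_on_mult oD smooth_on_snd[OF oD \<phi>(1)]
        smooth_on_linear[OF oD bounded_linear_fst] smooth_on_snd[OF oD x_sm] smooth_on_snd[OF oD \<nu>]) auto
  define \<Gamma> where "\<Gamma> p = (if snd p \<in> J then inv_into (dom_of c) (coord c) (X p) else \<gamma> (snd p))" for p
  have \<Gamma>_D: "\<Gamma> p \<in> dom_of c \<and> coord c (\<Gamma> p) = X p" if "p \<in> ?D" for p
    using X_img[OF that] that inv_into_into[of "X p" "coord c" "dom_of c"]
      f_inv_into_f[of "X p" "coord c" "dom_of c"] by (auto simp: \<Gamma>_def)
  have \<Gamma>_0: "\<Gamma> p = \<gamma> (snd p)" if "X p = coord c (\<gamma> (snd p))" for p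
    using that coord_inj[OF c] by (auto simp: \<Gamma>_def J)
  have \<Gamma>_outside: "\<Gamma> (u, t) = \<gamma> t" if "t \<notin> {a..b}" for u t
    using \<Gamma>_0[of "(u, t)"] X0[of "(u, t)"] \<phi>(2)[OF that] by simp
  have pre1: "open {p \<in> ?D. \<Gamma> p \<in> W}" if W: "openin N W" for W
  proof -
    have "{p \<in> ?D. \<Gamma> p \<in> W} = ?D \<inter> X -` (coord c ` (dom_of c \<inter> W))"
    proof (intro set_eqI iffI)
      fix p assume "p \<in> {p \<in> ?D. \<Gamma> p \<in> W}"
      then have "p \<in> ?D" "\<Gamma> p \<in> dom_of c \<inter> W" "coord c (\<Gamma> p) = X p" using \<Gamma>_D[of p] by auto
      then show "p \<in> ?D \<inter> X -` (coord c ` (dom_of c \<inter> W))" by (metis IntI imageI vimageI)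
    next
      fix p assume p: "p \<in> ?D \<inter> X -` (coord c ` (dom_of c \<inter> W))"
      then obtain q where q: "q \<in> dom_of c" "q \<in> W" "X p = coord c q" by auto
      then have "\<Gamma> p = q" using \<Gamma>_D[of p] p coord_inj[OF c] by (auto dest: inj_onD)
      then show "p \<in> {p \<in> ?D. \<Gamma> p \<in> W}" using p q by simp
    qed
    then show ?thesis
      using continuous_open_preimage[OF smooth_on_continuous_on[OF X_sm] oD open_coord_image[OF c W]] by simp
  qed
  have pre2: "open (?U \<times> {t \<in> I - {a..b}. \<gamma> t \<in> W})" if W: "openin N W" for W
  proof -
    have "openin (top_of_set I) {t \<in> I. \<gamma> t \<in> W}"
      using openin_continuous_map_preimage[OF \<gamma>_cont W] by simp
    then have "open {t \<in> I. \<gamma> t \<in> W}" using I by (simp add: openin_open_eq)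
    then have "open ({t \<in> I. \<gamma> t \<in> W} - {a..b})" by (intro open_Diff) auto
    moreover have "{t \<in> I. \<gamma> t \<in> W} - {a..b} = {t \<in> I - {a..b}. \<gamma> t \<in> W}" by auto
    ultimately show ?thesis by (intro open_Times) auto
  qed
  \<comment> \<open>Two overlapping open pieces: over \<open>J\<close> the chart formula holds, and
    off the closed interval \<open>{a..b}\<close> nothing moves. Continuity and smoothness are
    checked on each.\<close>
  have pre: "{p \<in> ?U \<times> I. \<Gamma> p \<in> W} = {p \<in> ?D. \<Gamma> p \<in> W} \<union> ?U \<times> {t \<in> I - {a..b}. \<gamma> t \<in> W}" for W
  proof (rule set_eqI, clarify)
    fix u t
    show "(u, t) \<in> {p \<in> ?U \<times> I. \<Gamma> p \<in> W} \<longleftrightarrow>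
        (u, t) \<in> {p \<in> ?D. \<Gamma> p \<in> W} \<union> ?U \<times> {t \<in> I - {a..b}. \<gamma> t \<in> W}"
    proof (cases "t \<in> {a..b}")
      case True
      then have "t \<in> J" "t \<in> I" using ab J by auto
      then show ?thesis using True by auto
    next
      case False
      then show ?thesis using \<Gamma>_outside[OF False, of u] J by auto
    qed
  qed
  have "continuous_map (top_of_set (?U \<times> I)) N \<Gamma>"
    unfolding continuous_map_def
  proof (intro conjI allI impI)
    have "\<Gamma> p \<in> topspace N" if "p \<in> ?U \<times> I" for p
    proof (cases "snd p \<in> J")
      case True
      then have "\<Gamma> p \<in> dom_of c" using \<Gamma>_D[of p] that by (auto simp: mem_Times_iff)
      then show ?thesis using openin_subset[OF chart_dom[OF c]] by auto
    next
      case False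
      then show ?thesis using continuous_map_image_subset_topspace[OF \<gamma>_cont] that by (auto simp: \<Gamma>_def)
    qed
    then show "\<Gamma> \<in> topspace (top_of_set (?U \<times> I)) \<rightarrow> topspace N" by simp
    fix W assume W: "openin N W"
    have "open {p \<in> ?U \<times> I. \<Gamma> p \<in> W}" unfolding pre by (intro open_Un pre1 pre2 W)
    moreover have "open (?U \<times> I)" by (intro open_Times I) auto
    ultimately show "openin (top_of_set (?U \<times> I)) {p \<in> topspace (top_of_set (?U \<times> I)). \<Gamma> p \<in> W}"
      by (simp add: openin_open_eq Collect_mono_iff)
  qed
  moreover have "smooth_on {p \<in> ?U \<times> I. \<Gamma> p \<in> dom_of c'} (coord c' \<circ> \<Gamma>)" if c': "c' \<in> A" for c'
  proof (rule smooth_on_local)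
    fix p assume p: "p \<in> {p \<in> ?U \<times> I. \<Gamma> p \<in> dom_of c'}"
    let ?V1 = "{p \<in> ?D. \<Gamma> p \<in> dom_of c'}" and ?V2 = "?U \<times> {t \<in> I - {a..b}. \<gamma> t \<in> dom_of c'}"
    have "smooth_on ?V1 (coord c' \<circ> \<Gamma>)"
    proof (rule smooth_on_cong[OF pre1[OF chart_dom[OF c']]])
      show "smooth_on ?V1 (\<lambda>p. transition c c' (X p))"
      proof (rule smooth_on_compose[OF pre1[OF chart_dom[OF c']] _ transition_smooth[OF c c']])
        show "X ` ?V1 \<subseteq> coord c ` (dom_of c \<inter> dom_of c')"
        proof (rule image_subsetI)
          fix p assume "p \<in> ?V1"
          then have "\<Gamma> p \<in> dom_of c \<inter> dom_of c'" "X p = coord c (\<Gamma> p)" using \<Gamma>_D[of p] by auto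
          then show "X p \<in> coord c ` (dom_of c \<inter> dom_of c')" by simp
        qed
        show "smooth_on ?V1 X" by (rule smooth_on_subset[OF X_sm]) auto
      qed
      fix p assume "p \<in> ?V1"
      then show "transition c c' (X p) = (coord c' \<circ> \<Gamma>) p"
        using \<Gamma>_D[of p] transition_coord[OF c, of "\<Gamma> p" c'] by auto
    qed
    moreover have "smooth_on ?V2 (coord c' \<circ> \<Gamma>)"
    proof (rule smooth_on_cong[OF pre2[OF chart_dom[OF c']]])
      have "smooth_on {t \<in> I. \<gamma> t \<in> dom_of c'} (coord c' \<circ> \<gamma>)"
        using \<gamma> c' by (simp add: smooth_into_def)
      then show "smooth_on ?V2 (\<lambda>p. (coord c' \<circ> \<gamma>) (snd p))"
        by (rule smooth_on_snd[OF pre2[OF chart_dom[OF c']]]) auto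
    qed (use \<Gamma>_outside in auto)
    ultimately show "\<exists>V. open V \<and> p \<in> V \<and> V \<subseteq> {p \<in> ?U \<times> I. \<Gamma> p \<in> dom_of c'} \<and> smooth_on V (coord c' \<circ> \<Gamma>)"
      using p pre1[OF chart_dom[OF c']] pre2[OF chart_dom[OF c']] unfolding pre[of "dom_of c'"] by blast
  qed
  moreover have "\<forall>t\<in>I. \<Gamma> (0, t) = \<gamma> t"
    using \<Gamma>_0 by (auto simp: X_def)
  moreover have "\<forall>u\<in>?U. \<forall>t\<in>I - {a..b}. \<Gamma> (u, t) = \<gamma> t" using \<Gamma>_outside by simp
  moreover have "{a..b} \<subseteq> I" using ab by (auto simp: J)
  ultimately have "variation N A I \<gamma> {a..b} \<epsilon> \<Gamma>"
    using \<epsilon> by (simp add: variation_def smooth_into_def)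
  then show ?thesis
    by (intro exI[of _ \<epsilon>] exI[of _ \<Gamma>] conjI X_sm image_subsetI ballI X_img \<Gamma>_D)
qed

end

section \<open>Frenet curves of constant curvature\<close>

text \<open>Vector fields along the curve are written as complex-valued functions in the frame
  \<open>(T, \<nu>)\<close>; covariant differentiation becomes \<open>z \<mapsto> z' + \<i> k z\<close>, and the curvature
  \<open>R(r \<nu>, T)\<close> becomes multiplication by \<open>\<i> K r\<close>.\<close>

context riemannian_surface
begin

text \<open>Order \<open>Suc m\<close> means \<open>m\<close> covariant derivatives of the velocity.
  Differentiation under the integral and metric compatibility give the first variation; the 2 from
  the product rule cancels the 1/2 in the energy.\<close>

lemma first_variation:
  assumes I: "open I" and c: "c \<in> A" and harm: "k_harmonic N A g (Suc m) I \<gamma>"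
    and J: "open J" "J \<subseteq> I" and ab: "{a..b} \<subseteq> J"
    and var: "variation N A I \<gamma> {a..b} \<epsilon> \<Gamma>"
    and X: "smooth_on ({-\<epsilon><..<\<epsilon>} \<times> J) X" "X ` ({-\<epsilon><..<\<epsilon>} \<times> J) \<subseteq> img c"
    and \<Gamma>: "\<And>p. p \<in> {-\<epsilon><..<\<epsilon>} \<times> J \<Longrightarrow> \<Gamma> p \<in> dom_of c \<and> coord c (\<Gamma> p) = X p"
  defines "W \<equiv> (cov_dir g c X (0, 1) ^^ m) (\<lambda>p. frechet_derivative X (at p) (0, 1))"
  shows "integral {a..b} (\<lambda>t. metric_inner g c (X (0, t)) (cov_dir g c X (1, 0) W (0, t)) (W (0, t))) = 0"
proof -
  let ?U = "{-\<epsilon><..<\<epsilon>}"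
  let ?D = "?U \<times> J"
  have \<epsilon>: "\<epsilon> > 0" and into: "smooth_into N A (?U \<times> I) \<Gamma>"
    using var by (auto simp: variation_def)
  have oD: "open ?D" by (intro open_Times J) auto
  have W: "smooth_on ?D W"
    unfolding W_def by (rule smooth_cov_dir_iterate[OF c oD X(2,1)])
  define F where "F p = metric_inner g c (X p) (W p) (W p)" for p
  have F: "smooth_on ?D F"
    unfolding F_def by (rule smooth_on_metric_inner[OF c oD X(2,1) W W])
  have F_cont: "continuous_on {a..b} (\<lambda>t. F (u, t))" if "u \<in> ?U" for u
    by (rule continuous_on_compose2[OF smooth_on_continuous_on[OF F]])
      (use that ab in \<open>auto intro!: continuous_intros\<close>)
  have energy: "integral {a..b} (\<lambda>t. F (u, t)) / 2 = k_energy A g (Suc m) {a..b} (\<lambda>t. \<Gamma> (u, t))"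
    if u: "u \<in> ?U" for u
  proof -
    let ?V = "(cov_deriv g (\<lambda>t. \<Gamma> (u, t)) ^^ m) (velocity (\<lambda>t. \<Gamma> (u, t)))"
    have V: "smooth_field_along A I (\<lambda>t. \<Gamma> (u, t)) ?V"
      by (rule smooth_field_iterate[OF I smooth_into_slice[OF into I u]])
    have "F (u, t) = inner_along A g (\<lambda>t. \<Gamma> (u, t)) ?V ?V t" if t: "t \<in> {a..b}" for t
    proof -
      have t': "t \<in> J" "t \<in> I" using t ab J by auto
      have "?V c t = W (u, t)"
        unfolding W_def
        by (rule iterate_in_chart[OF c oD X(2,1) J(1) _ t'(1)]) (use \<Gamma> u in auto)
      then show ?thesis
        using inner_along_chart[OF V V t'(2) c] \<Gamma>[of "(u, t)"] u t' by (simp add: F_def)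
    qed
    then have "integral {a..b} (\<lambda>t. F (u, t)) =
        integral {a..b} (\<lambda>t. inner_along A g (\<lambda>t. \<Gamma> (u, t)) ?V ?V t)"
      by (rule integral_cong)
    then show ?thesis by (simp add: k_energy_def Let_def)
  qed
  have "((\<lambda>u. integral (cbox a b) (\<lambda>t. F (u, t))) has_real_derivative
      integral (cbox a b) (\<lambda>t. frechet_derivative F (at (0, t)) (1, 0))) (at 0 within ?U)"
  proof (rule leibniz_rule_field_derivative[where f = "\<lambda>u t. F (u, t)" and
        fx = "\<lambda>u t. frechet_derivative F (at (u, t)) (1, 0)"])
    fix u t assume "u \<in> ?U" "t \<in> cbox a b"
    then have "(u, t) \<in> ?D" using ab by auto
    from slice_has_vector_derivative(2)[OF F this]
    show "((\<lambda>u. F (u, t)) has_real_derivative frechet_derivative F (at (u, t)) (1, 0)) (at u within ?U)"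
      by (simp add: has_real_derivative_iff_has_vector_derivative has_vector_derivative_at_within)
  next
    show "(\<lambda>t. F (u, t)) integrable_on cbox a b" if "u \<in> ?U" for u
      using integrable_continuous_real[OF F_cont[OF that]] by simp
    have "continuous_on (?U \<times> cbox a b) (\<lambda>p. frechet_derivative F (at p) (1, 0))"
      using ab by (intro continuous_on_subset[OF smooth_on_continuous_on[OF smooth_on_frechet[OF F]]]) auto
    then show "continuous_on (?U \<times> cbox a b) (\<lambda>(u, t). frechet_derivative F (at (u, t)) (1, 0))"
      by (simp add: case_prod_unfold)
  qed (use \<epsilon> in auto)
  then have "((\<lambda>u. integral {a..b} (\<lambda>t. F (u, t)) / 2) has_real_derivative
      integral {a..b} (\<lambda>t. frechet_derivative F (at (0, t)) (1, 0)) / 2) (at 0)"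
    using \<epsilon> by (intro DERIV_cdivide) (simp add: at_within_open[of 0 ?U])
  then have "((\<lambda>u. k_energy A g (Suc m) {a..b} (\<lambda>t. \<Gamma> (u, t))) has_real_derivative
      integral {a..b} (\<lambda>t. frechet_derivative F (at (0, t)) (1, 0)) / 2) (at 0)"
    by (rule has_field_derivative_transform_within_open[of _ _ _ ?U]) (use \<epsilon> energy in auto)
  moreover have "((\<lambda>u. k_energy A g (Suc m) {a..b} (\<lambda>t. \<Gamma> (u, t))) has_real_derivative 0) (at 0)"
    using harm var by (auto simp: k_harmonic_def)
  ultimately have F0: "integral {a..b} (\<lambda>t. frechet_derivative F (at (0, t)) (1, 0)) = 0"
    using DERIV_unique by force
  have D: "frechet_derivative F (at (0, t)) (1, 0) =
      2 * metric_inner g c (X (0, t)) (cov_dir g c X (1, 0) W (0, t)) (W (0, t))" if "t \<in> {a..b}" for t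
  proof -
    have p: "(0, t) \<in> ?D" using that ab \<epsilon> by auto
    have x: "X (0, t) \<in> img c" using X(2) p by blast
    have "((\<lambda>s. F (s, t)) has_real_derivative frechet_derivative F (at (0, t)) (1, 0)) (at 0)"
      using slice_has_vector_derivative(2)[OF F p] by (simp add: has_real_derivative_iff_has_vector_derivative)
    moreover have "((\<lambda>s. F (s, t)) has_real_derivative
        metric_inner g c (X (0, t)) (cov_dir g c X (1, 0) W (0, t)) (W (0, t)) +
        metric_inner g c (X (0, t)) (W (0, t)) (cov_dir g c X (1, 0) W (0, t))) (at 0)"
      unfolding F_def cov_dir_def
      by (rule metric_inner_has_derivative[where X = "\<lambda>s. X (s, t)", OF c x slice_has_vector_derivative(2)[OF X(1) p]
            slice_has_vector_derivative(2)[OF W p] slice_has_vector_derivative(2)[OF W p]])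
    ultimately show ?thesis
      using DERIV_unique metric_inner_sym[OF c x] by fastforce
  qed
  have "integral {a..b} (\<lambda>t. frechet_derivative F (at (0, t)) (1, 0)) =
      integral {a..b} (\<lambda>t. 2 * metric_inner g c (X (0, t)) (cov_dir g c X (1, 0) W (0, t)) (W (0, t)))"
    by (rule integral_cong[OF D])
  then show ?thesis using F0 by simp
qed

text \<open>One bump around \<open>t0\<close> is enough because \<open>k\<close> and
  \<open>K\<close> are constants. For \<open>k = 0\<close> and positive \<open>m\<close> the field
  \<open>W m\<close> would vanish along the curve and the test would say nothing; hence the
  hypothesis \<open>k \<noteq> 0\<close>.\<close>

lemma constant_curvature_harmonic:
  assumes I: "open I" and harm: "k_harmonic N A g (Suc m) I \<gamma>"
    and curv: "constant_sectional_curvature A g K"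
    and arc: "arc_length_parametrized A g I \<gamma>" and fr: "frenet A g I \<gamma> n (\<lambda>t. k)"
    and t0: "t0 \<in> I" and k: "k \<noteq> 0"
  shows "k\<^sup>2 = real m * K"
proof -
  have \<gamma>: "smooth_into N A I \<gamma>" using harm by (simp add: k_harmonic_def)
  have \<gamma>_cont: "continuous_map (top_of_set I) N \<gamma>" using \<gamma> by (simp add: smooth_into_def)
  have "\<gamma> t0 \<in> \<Union> (dom_of ` A)"
    unfolding cover using continuous_map_image_subset_topspace[OF \<gamma>_cont] t0 by auto
  then obtain c where c: "c \<in> A" "\<gamma> t0 \<in> dom_of c" by blast
  define J where "J = {t \<in> I. \<gamma> t \<in> dom_of c}"
  have oJ: "open J" unfolding J_def by (rule chart_preimage_open[OF I \<gamma>_cont c(1)])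
  have JI: "J \<subseteq> I" by (auto simp: J_def)
  obtain d where d: "d > 0" "cball t0 d \<subseteq> J"
    using open_contains_cball[THEN iffD1, OF oJ] t0 c(2) by (auto simp: J_def)
  \<comment> \<open>\<open>{a..b}\<close> is the support allowed to the variation; the bump lives
    strictly inside it, so everything built from the bump vanishes at \<open>a\<close> and
    \<open>b\<close> and no boundary terms arise.\<close>
  define a b where "a = t0 - d" and "b = t0 + d"
  define a' b' where "a' = t0 - d / 2" and "b' = t0 + d / 2"
  have ab: "{a..b} \<subseteq> J" using d(2) by (auto simp: a_def b_def cball_def dist_real_def subset_iff)
  have ord: "a < a'" "a' < b'" "b' < b" using d(1) by (auto simp: a_def b_def a'_def b'_def)
  obtain \<phi> :: "real \<Rightarrow> real" where "smooth_on UNIV \<phi> \<and> (\<forall>t. t \<notin> {a'<..<b'} \<longrightarrow> \<phi> t = 0) \<and> (\<forall>t\<in>{a'<..<b'}. \<phi> t > 0)"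
    using bump_function[of a' b'] ..
  then have \<phi>: "smooth_on UNIV \<phi>" "\<And>t. t \<notin> {a'<..<b'} \<Longrightarrow> \<phi> t = 0" "\<And>t. t \<in> {a'<..<b'} \<Longrightarrow> \<phi> t > 0"
    by simp_all
  define x where "x = (\<lambda>t. coord c (\<gamma> t))"
  define T where "T = velocity \<gamma> c"
  define \<nu> where "\<nu> = n c"
  have fields: "smooth_field_along A I \<gamma> n" "smooth_field_along A I \<gamma> (velocity \<gamma>)"
    using fr smooth_field_velocity[OF I \<gamma>] by (simp_all add: frenet_def)
  have T_sm: "smooth_on J T" and \<nu>_sm: "smooth_on J \<nu>"
    unfolding T_def \<nu>_def J_def using fields[THEN smooth_field_smooth, OF c(1)] by simp_all
  have on: "metric_inner g c (x t) (T t) (T t) = 1" "metric_inner g c (x t) (\<nu> t) (\<nu> t) = 1"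
      "metric_inner g c (x t) (\<nu> t) (T t) = 0" if "t \<in> J" for t
    using that arc fr inner_along_chart[OF fields(2,2) _ c(1), of t] inner_along_chart[OF fields(1,1) _ c(1), of t]
      inner_along_chart[OF fields(1,2) _ c(1), of t]
    by (auto simp: J_def x_def T_def \<nu>_def arc_length_parametrized_def frenet_def)
  have covT: "vector_derivative T (at t) + chris g c (x t) (T t) (T t) = k *\<^sub>R \<nu> t"
    and cov\<nu>: "vector_derivative \<nu> (at t) + chris g c (x t) (T t) (\<nu> t) = - k *\<^sub>R T t" if "t \<in> J" for t
    using that fr c(1)
    by (auto simp: J_def x_def T_def \<nu>_def frenet_def fields_eq_def cov_deriv_chris)
  have \<phi>_zero: "\<phi> t = 0" if "t \<notin> {a..b}" for t using \<phi>(2) that ord by auto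
  define X where "X = (\<lambda>p. coord c (\<gamma> (snd p)) + (fst p * \<phi> (snd p)) *\<^sub>R \<nu> (snd p))"
  obtain \<epsilon> \<Gamma> where "variation N A I \<gamma> {a..b} \<epsilon> \<Gamma> \<and>
      smooth_on ({-\<epsilon><..<\<epsilon>} \<times> J) X \<and> X ` ({-\<epsilon><..<\<epsilon>} \<times> J) \<subseteq> img c \<and>
      (\<forall>p \<in> {-\<epsilon><..<\<epsilon>} \<times> J. \<Gamma> p \<in> dom_of c \<and> coord c (\<Gamma> p) = X p)"
    unfolding X_def using chart_variation[OF I \<gamma> c(1) J_def \<nu>_sm ab \<phi>(1) \<phi>_zero] by blast
  then have var: "variation N A I \<gamma> {a..b} \<epsilon> \<Gamma>"
    and X: "smooth_on ({-\<epsilon><..<\<epsilon>} \<times> J) X" "X ` ({-\<epsilon><..<\<epsilon>} \<times> J) \<subseteq> img c"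
      "\<And>p. p \<in> {-\<epsilon><..<\<epsilon>} \<times> J \<Longrightarrow> \<Gamma> p \<in> dom_of c \<and> coord c (\<Gamma> p) = X p"
    by blast+
  let ?D = "{-\<epsilon><..<\<epsilon>} \<times> J"
  have \<epsilon>: "\<epsilon> > 0" using var by (simp add: variation_def)
  have oD: "open ?D" by (intro open_Times oJ) auto
  have in_D: "(0, t) \<in> ?D" if "t \<in> J" for t using that \<epsilon> by simp
  have X0: "X (0, t) = x t" for t by (simp add: X_def x_def)
  have x_img: "x t \<in> img c" if "t \<in> J" for t using that by (auto simp: x_def J_def)
  have Xt: "frechet_derivative X (at (0, t)) (0, 1) = T t" if "t \<in> J" for t
    unfolding T_def by (rule velocity_in_chart[OF X(1) oJ _ that, symmetric]) (use X0 in_D in \<open>auto simp: x_def\<close>)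
  have Xu: "frechet_derivative X (at (0, t)) (1, 0) = \<phi> t *\<^sub>R \<nu> t" if "t \<in> J" for t
  proof (rule vector_derivative_unique_at)
    show "((\<lambda>s. X (s, t)) has_vector_derivative frechet_derivative X (at (0, t)) (1, 0)) (at 0)"
      by (rule slice_has_vector_derivative(2)[OF X(1) in_D[OF that]])
    show "((\<lambda>s. X (s, t)) has_vector_derivative \<phi> t *\<^sub>R \<nu> t) (at 0)"
      unfolding X_def by (auto intro!: derivative_eq_intros simp: has_vector_derivative_def)
  qed
  define F where "F t z = Re z *\<^sub>R T t + Im z *\<^sub>R \<nu> t" for t and z :: complex
  \<comment> \<open>The direction \<open>(0, 1)\<close> is tangent to the undeformed curve, so the
    values of \<open>V\<close> there determine this derivative; the Frenet equations supply the
    multiplication by \<open>\<i> * of_real k\<close>.\<close>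
  have cov_frame: "cov_dir g c X (0, 1) V (0, t) = F t (z' + \<i> * of_real k * z t)"
    if V: "smooth_on ?D V" "\<And>t. t \<in> J \<Longrightarrow> V (0, t) = F t (z t)"
      and z: "(z has_vector_derivative z') (at t)" and t: "t \<in> J" for V z z' t
  proof -
    have Re: "((\<lambda>s. Re (z s)) has_real_derivative Re z') (at t)"
      and Im: "((\<lambda>s. Im (z s)) has_real_derivative Im z') (at t)"
      using bounded_linear.has_vector_derivative[OF bounded_linear_Re z]
        bounded_linear.has_vector_derivative[OF bounded_linear_Im z]
      by (simp_all add: has_real_derivative_iff_has_vector_derivative)
    have "((\<lambda>s. F s (z s)) has_vector_derivative
        (Re (z t) *\<^sub>R vector_derivative T (at t) + Re z' *\<^sub>R T t) +
        (Im (z t) *\<^sub>R vector_derivative \<nu> (at t) + Im z' *\<^sub>R \<nu> t)) (at t)"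
      unfolding F_def
      by (intro has_vector_derivative_add has_vector_derivative_scaleR Re Im
          smooth_on_has_vector_derivative[OF T_sm t] smooth_on_has_vector_derivative[OF \<nu>_sm t])
    then have "((\<lambda>s. V (0, s)) has_vector_derivative
        (Re (z t) *\<^sub>R vector_derivative T (at t) + Re z' *\<^sub>R T t) +
        (Im (z t) *\<^sub>R vector_derivative \<nu> (at t) + Im z' *\<^sub>R \<nu> t)) (at t)"
      by (rule has_vector_derivative_transform_within_open[OF _ oJ t]) (simp add: V(2))
    then have "frechet_derivative V (at (0, t)) (0, 1) =
        (Re (z t) *\<^sub>R vector_derivative T (at t) + Re z' *\<^sub>R T t) +
        (Im (z t) *\<^sub>R vector_derivative \<nu> (at t) + Im z' *\<^sub>R \<nu> t)"
      using slice_has_vector_derivative(1)[OF V(1) in_D[OF t]] vector_derivative_unique_at by blast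
    then have "cov_dir g c X (0, 1) V (0, t) =
        Re z' *\<^sub>R T t + Im z' *\<^sub>R \<nu> t +
        Re (z t) *\<^sub>R (vector_derivative T (at t) + chris g c (x t) (T t) (T t)) +
        Im (z t) *\<^sub>R (vector_derivative \<nu> (at t) + chris g c (x t) (T t) (\<nu> t))"
      by (simp add: cov_dir_def X0 Xt[OF t] V(2)[OF t] F_def[of t "z t"] chris_simps scaleR_add_right)
    then show ?thesis
      unfolding covT[OF t] cov\<nu>[OF t] by (simp add: F_def algebra_simps)
  qed
  define W where "W j = (cov_dir g c X (0, 1) ^^ j) (\<lambda>p. frechet_derivative X (at p) (0, 1))" for j
  have W_sm: "smooth_on ?D (W j)" for j
    unfolding W_def by (rule smooth_cov_dir_iterate[OF c(1) oD X(2,1)])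
  have W_Suc: "W (Suc j) = cov_dir g c X (0, 1) (W j)" for j by (simp add: W_def)
  define w where "w j = (\<i> * of_real k) ^ j" for j :: nat
  have W0: "W j (0, t) = F t (w j)" if "t \<in> J" for j t
    using that
  proof (induction j arbitrary: t)
    case 0
    then show ?case by (simp add: W_def w_def F_def Xt)
  next
    case (Suc j)
    show ?case
      unfolding W_Suc using cov_frame[OF W_sm[of j] Suc.IH has_vector_derivative_const Suc.prems]
      by (simp add: w_def)
  qed
  define \<Phi> where "\<Phi> = integral {a..b} \<phi>"
  have \<phi>_int: "(\<phi> has_integral \<Phi>) {a..b}"
    unfolding \<Phi>_def
    by (intro integrable_integral integrable_continuous_real continuous_on_subset[OF smooth_on_continuous_on[OF \<phi>(1)]]) simp
  have \<phi>_int_c: "((\<lambda>t. complex_of_real (\<phi> t)) has_integral of_real \<Phi>) {a..b}"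
    using has_integral_linear[OF \<phi>_int bounded_linear_of_real] by (simp add: o_def)
  have \<Phi>: "\<Phi> \<noteq> 0"
  proof
    assume "\<Phi> = 0"
    moreover have "continuous_on {a..b} \<phi>" by (rule continuous_on_subset[OF smooth_on_continuous_on[OF \<phi>(1)]]) simp
    moreover have "\<phi> t \<ge> 0" for t using \<phi>(2,3)[of t] by (cases "t \<in> {a'<..<b'}") auto
    ultimately have "\<phi> t0 = 0" using integral_eq_0_iff[of a b \<phi>] d(1) by (simp add: \<Phi>_def a_def b_def)
    then show False using \<phi>(3)[of t0] d(1) by (simp add: a'_def b'_def)
  qed
  have \<phi>c: "smooth_on UNIV (\<lambda>t. complex_of_real (\<phi> t))"
    by (rule smooth_on_bounded_linear[OF open_UNIV bounded_linear_of_real \<phi>(1)])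
  have deriv_int: "((\<lambda>t. vector_derivative z (at t)) has_integral 0) {a..b}"
    and deriv_zero: "\<And>t. t \<notin> {a'..b'} \<Longrightarrow> vector_derivative z (at t) = 0"
    if z: "smooth_on UNIV z" "\<And>t. t \<notin> {a'..b'} \<Longrightarrow> z t = 0" for z :: "real \<Rightarrow> complex"
  proof -
    have "((\<lambda>t. vector_derivative z (at t)) has_integral z b - z a) {a..b}"
      by (rule fundamental_theorem_of_calculus)
        (use ord smooth_on_has_vector_derivative[OF z(1)] in \<open>auto intro: has_vector_derivative_at_within\<close>)
    then show "((\<lambda>t. vector_derivative z (at t)) has_integral 0) {a..b}"
      using z(2)[of a] z(2)[of b] ord by simp
    fix t assume t: "t \<notin> {a'..b'}"
    have "((\<lambda>t. 0) has_vector_derivative (0::complex)) (at t)" by (rule has_vector_derivative_const)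
    then have "(z has_vector_derivative 0) (at t)"
      by (rule has_vector_derivative_transform_within_open[of _ _ _ "- {a'..b'}"]) (use t z(2) in auto)
    then show "vector_derivative z (at t) = 0" by (rule vector_derivative_at)
  qed
  \<comment> \<open>\<open>z\<close> is a function on the whole line although it represents the
    field only over \<open>J\<close>; this frees its derivative and integral from side conditions.
    The formula for \<open>Z\<close> is kept multiplied by \<open>\<i> * of_real k\<close>, which
    avoids dividing by \<open>k\<close>.\<close>
  have "\<exists>z Z. smooth_on UNIV z \<and> (\<forall>t. t \<notin> {a'..b'} \<longrightarrow> z t = 0) \<and>
      (\<forall>t\<in>J. cov_dir g c X (1, 0) (W j) (0, t) = F t (z t)) \<and> (z has_integral Z) {a..b} \<and>
      \<i> * of_real k * Z = \<i> * of_real \<Phi> * w j * of_real (real j * K - k\<^sup>2)" for j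
  proof (induction j)
    case 0
    \<comment> \<open>The variation field \<open>\<phi> t *\<^sub>R \<nu> t\<close> in complex
      notation; absence of torsion makes its covariant derivative \<open>?z\<close> the variation of
      the velocity.\<close>
    let ?y = "\<lambda>t. \<i> * complex_of_real (\<phi> t)"
    let ?z = "\<lambda>t. vector_derivative ?y (at t) + \<i> * of_real k * ?y t"
    have y: "smooth_on UNIV ?y" "\<And>t. t \<notin> {a'..b'} \<Longrightarrow> ?y t = 0"
      using \<phi>(2) by (auto intro!: smooth_on_mult smooth_on_const \<phi>c)
    have "smooth_on UNIV ?z"
      by (intro smooth_on_add smooth_on_vector_derivative smooth_on_mult smooth_on_const y(1) \<phi>c open_UNIV)
    moreover have "\<forall>t. t \<notin> {a'..b'} \<longrightarrow> ?z t = 0" using deriv_zero[OF y] y(2) by simp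
    moreover have "cov_dir g c X (1, 0) (W 0) (0, t) = F t (?z t)" if t: "t \<in> J" for t
    proof -
      have "cov_dir g c X (1, 0) (W 0) (0, t) =
          cov_dir g c X (0, 1) (\<lambda>p. frechet_derivative X (at p) (1, 0)) (0, t)"
        using cov_dir_torsion_free[OF c(1) oD X(2,1) in_D[OF t]] by (simp add: W_def)
      also have "\<dots> = F t (?z t)"
      proof (rule cov_frame[OF smooth_on_frechet[OF X(1)] _ _ t])
        show "(?y has_vector_derivative vector_derivative ?y (at t)) (at t)"
          by (rule smooth_on_has_vector_derivative[OF y(1)]) simp
        show "frechet_derivative X (at (0, t)) (1, 0) = F t (?y t)" if "t \<in> J" for t
          using Xu[OF that] by (simp add: F_def)
      qed
      finally show ?thesis .
    qed
    moreover have "(?z has_integral 0 + \<i> * of_real k * (\<i> * of_real \<Phi>)) {a..b}"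
      by (intro has_integral_add deriv_int[OF y] has_integral_mult_right \<phi>_int_c)
    moreover have "\<i> * of_real k * (0 + \<i> * of_real k * (\<i> * of_real \<Phi>)) =
        \<i> * of_real \<Phi> * w 0 * of_real (real 0 * K - k\<^sup>2)"
      by (simp add: w_def complex_eq_iff power2_eq_square)
    ultimately show ?case by blast
  next
    case (Suc j)
    then obtain z Z where z: "smooth_on UNIV z" "\<And>t. t \<notin> {a'..b'} \<Longrightarrow> z t = 0"
      "\<And>t. t \<in> J \<Longrightarrow> cov_dir g c X (1, 0) (W j) (0, t) = F t (z t)" "(z has_integral Z) {a..b}"
      and Z: "\<i> * of_real k * Z = \<i> * of_real \<Phi> * w j * of_real (real j * K - k\<^sup>2)"
      by blast
    let ?z = "\<lambda>t. vector_derivative z (at t) + \<i> * of_real k * z t + \<i> * of_real K * w j * of_real (\<phi> t)"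
    have "smooth_on UNIV ?z"
      by (intro smooth_on_add smooth_on_vector_derivative smooth_on_mult smooth_on_const z(1) \<phi>c open_UNIV)
    moreover have "\<forall>t. t \<notin> {a'..b'} \<longrightarrow> ?z t = 0" using deriv_zero[OF z(1,2)] z(2) \<phi>(2) by auto
    moreover have "cov_dir g c X (1, 0) (W (Suc j)) (0, t) = F t (?z t)" if t: "t \<in> J" for t
    proof -
      have "cov_dir g c X (1, 0) (W (Suc j)) (0, t) = cov_dir g c X (0, 1) (cov_dir g c X (1, 0) (W j)) (0, t) +
          riemann g c (x t) (\<phi> t *\<^sub>R \<nu> t) (T t) (F t (w j))"
        unfolding W_Suc cov_dir_commute[where e = "(1, 0)" and f = "(0, 1)", OF c(1) oD X(2,1) W_sm in_D[OF t]] X0 Xu[OF t] Xt[OF t] W0[OF t] ..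
      also have "cov_dir g c X (0, 1) (cov_dir g c X (1, 0) (W j)) (0, t) =
          F t (vector_derivative z (at t) + \<i> * of_real k * z t)"
        by (rule cov_frame[OF smooth_cov_dir[OF c(1) oD X(2,1) W_sm] z(3) smooth_on_has_vector_derivative[OF z(1)] t]) simp_all
      also have "riemann g c (x t) (\<phi> t *\<^sub>R \<nu> t) (T t) (F t (w j)) =
          (\<phi> t * K) *\<^sub>R (Re (w j) *\<^sub>R \<nu> t - Im (w j) *\<^sub>R T t)"
        unfolding F_def by (rule riemann_constant_curvature[OF curv c(1) x_img[OF t] on[OF t]])
      finally show ?thesis by (simp add: F_def algebra_simps)
    qed
    moreover have "(?z has_integral 0 + \<i> * of_real k * Z + \<i> * of_real K * w j * of_real \<Phi>) {a..b}"
      by (intro has_integral_add deriv_int[OF z(1,2)] has_integral_mult_right z(4) \<phi>_int_c)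
    \<comment> \<open>The new curvature term raises the coefficient of \<open>K\<close> from
      \<open>j\<close> to \<open>Suc j\<close>.\<close>
    moreover have "\<i> * of_real k * (0 + \<i> * of_real k * Z + \<i> * of_real K * w j * of_real \<Phi>) =
        \<i> * of_real \<Phi> * w (Suc j) * of_real (real (Suc j) * K - k\<^sup>2)"
    proof -
      have "\<i> * of_real k * (0 + \<i> * of_real k * Z + \<i> * of_real K * w j * of_real \<Phi>) =
          \<i> * of_real k * (\<i> * of_real \<Phi> * w j * of_real (real j * K - k\<^sup>2) + \<i> * of_real K * w j * of_real \<Phi>)"
        by (simp only: Z add_0_left)
      also have "\<dots> = \<i> * of_real \<Phi> * (\<i> * of_real k * w j) * of_real (real (Suc j) * K - k\<^sup>2)"
        by (simp add: algebra_simps)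
      finally show ?thesis by (simp add: w_def)
    qed
    ultimately show ?case by blast
  qed
  from this[of m] obtain z Z where z: "\<And>t. t \<in> J \<Longrightarrow> cov_dir g c X (1, 0) (W m) (0, t) = F t (z t)"
    and zZ: "(z has_integral Z) {a..b}"
    and Z: "\<i> * of_real k * Z = \<i> * of_real \<Phi> * w m * of_real (real m * K - k\<^sup>2)" by blast
  \<comment> \<open>In an orthonormal frame the metric is the real part of the Hermitian product. As
    \<open>w m\<close> does not depend on \<open>t\<close>, pairing with it commutes with the
    integral.\<close>
  have inner: "metric_inner g c (x t) (F t y) (F t y') = Re (y * cnj y')" if "t \<in> J" for t y y'
    using on[OF that] metric_inner_sym[OF c(1) x_img[OF that], of "T t" "\<nu> t"]
    by (simp add: F_def metric_inner_simps)
  have "((\<lambda>t. Re (z t * cnj (w m))) has_integral Re (Z * cnj (w m))) {a..b}"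
    using has_integral_linear[OF has_integral_mult_left[OF zZ] bounded_linear_Re] by (simp only: o_def)
  then have "integral {a..b} (\<lambda>t. Re (z t * cnj (w m))) = Re (Z * cnj (w m))" by (rule integral_unique)
  moreover have "integral {a..b} (\<lambda>t. Re (z t * cnj (w m))) = 0"
  proof -
    have "integral {a..b} (\<lambda>t. metric_inner g c (X (0, t)) (cov_dir g c X (1, 0) (W m) (0, t)) (W m (0, t))) = 0"
      unfolding W_def by (rule first_variation[OF I c(1) harm oJ JI ab var X])
    moreover have integrand: "metric_inner g c (X (0, t)) (cov_dir g c X (1, 0) (W m) (0, t)) (W m (0, t)) =
        Re (z t * cnj (w m))" if "t \<in> {a..b}" for t
    proof -
      have t: "t \<in> J" using that ab by blast
      show ?thesis unfolding X0 z[OF t] W0[OF t] by (rule inner[OF t])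
    qed
    ultimately show ?thesis by (simp only: integral_cong[OF integrand])
  qed
  ultimately have Re0: "Re (Z * cnj (w m)) = 0" by simp
  have Re_scale: "Re (of_real k * y) = k * Re y" for y by simp
  \<comment> \<open>Cancelling the factor \<open>\<i>\<close> shows \<open>of_real k * Z\<close> to
    be a real multiple of \<open>w m\<close>; after multiplication with the conjugate of
    \<open>w m\<close> it is real, and taking real parts loses nothing.\<close>
  have "of_real k * Z = of_real (\<Phi> * (real m * K - k\<^sup>2)) * w m"
    using Z by (simp add: mult_ac)
  then have "of_real k * (Z * cnj (w m)) = of_real (\<Phi> * (real m * K - k\<^sup>2) * (cmod (w m))\<^sup>2)"
    by (simp only: mult.assoc[symmetric]) (simp only: mult.assoc of_real_mult complex_norm_square)
  then have "k * Re (Z * cnj (w m)) = \<Phi> * (real m * K - k\<^sup>2) * (cmod (w m))\<^sup>2"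
    using Re_scale[of "Z * cnj (w m)"] by (simp only: Re_complex_of_real)
  then have "\<Phi> * (real m * K - k\<^sup>2) * (cmod (w m))\<^sup>2 = 0" using Re0 by simp
  \<comment> \<open>The modulus of \<open>w m\<close> is a power of the absolute value of
    \<open>k\<close>, so only the middle factor can vanish.\<close>
  then show ?thesis using \<Phi> k by (simp add: w_def)
qed

end

text \<open>Geodesics are critical for these energies and have curvature 0, so
  \<open>non_geodesic\<close> keeps them out when \<open>K\<close> is positive. The absolute value
  reflects that replacing \<open>n\<close> by its opposite changes the sign of
  \<open>\<kappa>\<close>.\<close>

theorem proposition5p6:
  fixes N :: "'a topology" and A :: "'a chart set" and g :: "'a metric_family"
    and s :: nat and K :: real and I :: "real set" and \<gamma> :: "real \<Rightarrow> 'a"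
    and n :: "'a field_along" and \<kappa> :: "real \<Rightarrow> real"
  assumes "s \<ge> 1"
    and "riemannian_surface N A g"
    and "constant_sectional_curvature A g K" and "K \<ge> 0"
    and "open I" and "is_interval I"
    and "k_harmonic N A g (2 * s) I \<gamma>"
    and "arc_length_parametrized A g I \<gamma>"
    and "frenet A g I \<gamma> n \<kappa>"
    and "\<kappa> constant_on I"
    and non_geodesic: "K > 0 \<Longrightarrow> \<not> geodesic A g I \<gamma>"
  shows "\<forall>t\<in>I. \<bar>\<kappa> t\<bar> = sqrt ((2 * real s - 1) * K)"
proof
  fix t assume t: "t \<in> I"
  interpret riemannian_surface N A g by fact
  obtain k where k: "\<And>t. t \<in> I \<Longrightarrow> \<kappa> t = k" using assms(10) by (auto simp: constant_on_def)
  have fr: "frenet A g I \<gamma> n (\<lambda>t. k)"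
    using assms(9) k by (simp add: frenet_def fields_eq_def)
  have "k\<^sup>2 = (2 * real s - 1) * K"
  proof (cases "k = 0")
    case True
    \<comment> \<open>Zero curvature means vanishing tension; \<open>non_geodesic\<close> then
      leaves \<open>K = 0\<close>, where both sides vanish.\<close>
    have "geodesic A g I \<gamma>"
      using fr True by (simp add: geodesic_def frenet_def tension_def)
    then have "K = 0" using non_geodesic assms(4) by force
    then show ?thesis using True by simp
  next
    case False
    \<comment> \<open>The energy of order \<open>2 * s\<close> involves \<open>2 * s - 1\<close>
      covariant derivatives of the velocity, the constant in the claim; \<open>s \<ge> 1\<close>
      makes the truncated subtraction exact.\<close>
    have "Suc (2 * s - 1) = 2 * s" using assms(1) by simp
    then have "k\<^sup>2 = real (2 * s - 1) * K"
      using constant_curvature_harmonic[OF assms(5) _ assms(3,8) fr t False, of "2 * s - 1"] assms(7) by simp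
    then show ?thesis using assms(1) by (simp add: of_nat_diff)
  qed
  then show "\<bar>\<kappa> t\<bar> = sqrt ((2 * real s - 1) * K)" using k[OF t] real_sqrt_abs[of k] by simp
qed

end
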